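(* Let $G=(V,E)$ be a finite graph with parameters $J_{ij},h_i\in\mathbb{R}$, and let $F_{\mathrm B}$ be the Bethe free energy on $L$ defined in the context. If $\det\nabla^2F_{\mathrm B}(\eta)\ne0$ for every $\eta\in L$ with $\nabla F_{\mathrm B}(\eta)=0$, then $$\sum_{\eta\in L:\ \nabla F_{\mathrm B}(\eta)=0}\operatorname{sgn}\big(\det\nabla^2F_{\mathrm B}(\eta)\big)=1.$$
   Context: Binary pairwise model $p(x)\propto\exp(\sum_{ij\in E}J_{ij}x_ix_j+\sum_{i\in V}h_ix_i)$, $x_i\in\{\pm1\}$; $d_i$ is the degree of $i$. Coordinates $\eta=(\{m_i\}_{i\in V},\{\chi_{ij}\}_{ij\in E})\in\mathbb{R}^{|V|+|E|}$; $L=\{\eta:|m_i|<1\ \forall i,\ 1+m_ix_i+m_jx_j+\chi_{ij}x_ix_j>0\ \forall ij\in E,\ x_i,x_j\in\{\pm1\}\}$. With $\eta(t)=t\log t$ (here written $H(t)$ to avoid a clash), the Bethe free energy is $F_{\mathrm B}=-\sum_{ij}J_{ij}\chi_{ij}-\sum_ih_im_i+\sum_{ij\in E}\sum_{x_i,x_j=\pm1}H\big(\tfrac{1+m_ix_i+m_jx_j+\chi_{ij}x_ix_j}{4}\big)+\sum_{i\in V}(1-d_i)\sum_{x_i=\pm1}H\big(\tfrac{1+m_ix_i}{2}\big)$. Its stationary points in $L$ are exactly the fixed points of loopy belief propagation. $\operatorname{sgn}(x)=\pm1$ according to the sign of $x\neq0$. *)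

theory Defs
  imports "HOL-Analysis.Analysis"
begin

text \<open>
  An edge is the two-element set of its endpoints, so edge quantities such as
  \<open>J\<close> and \<open>chi\<close> are functions on sets of vertices.
\<close>

definition finite_graph :: "'v set \<Rightarrow> 'v set set \<Rightarrow> bool" where
  "finite_graph V E \<longleftrightarrow> finite V \<and> (\<forall>e\<in>E. e \<subseteq> V \<and> card e = 2)"

definition vertex_degree :: "'v set set \<Rightarrow> 'v \<Rightarrow> nat" where
  "vertex_degree E i = card {e\<in>E. i \<in> e}"

definition x_ln_x :: "real \<Rightarrow> real" where
  "x_ln_x t = t * ln t"

text \<open>
  The summand for an edge \<open>e = {i, j}\<close>. Spin assignments \<open>x\<close> range over the
  functions from \<open>e\<close> to \<open>{1, -1}\<close>; this avoids choosing an order of the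
  endpoints. See \<open>edge_entropy_doubleton\<close> for the explicit double sum.
\<close>

definition edge_entropy :: "('v \<Rightarrow> real) \<Rightarrow> ('v set \<Rightarrow> real) \<Rightarrow> 'v set \<Rightarrow> real" where
  "edge_entropy m chi e =
     (\<Sum>x \<in> e \<rightarrow>\<^sub>E {1, -1}. x_ln_x ((1 + (\<Sum>i\<in>e. m i * x i) + chi e * (\<Prod>i\<in>e. x i)) / 4))"

lemma edge_entropy_doubleton:
  assumes "i \<noteq> j"
  shows "edge_entropy m chi {i, j} =
    (\<Sum>x\<in>{1, -1}. \<Sum>y\<in>{1, -1}. x_ln_x ((1 + m i * x + m j * y + chi {i, j} * x * y) / 4))"
proof -
  have "edge_entropy m chi {i, j} =
    (\<Sum>(x, y)\<in>{1, -1} \<times> {1, -1}. x_ln_x ((1 + m i * x + m j * y + chi {i, j} * x * y) / 4))"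
    unfolding edge_entropy_def
  proof (rule sum.reindex_bij_witness
      [where i = "\<lambda>(x, y). \<lambda>k\<in>{i, j}. if k = i then x else y" and j = "\<lambda>x. (x i, x j)"])
    fix x :: "'a \<Rightarrow> real"
    assume x: "x \<in> {i, j} \<rightarrow>\<^sub>E {1, -1}"
    show "(case (x i, x j) of (a, b) \<Rightarrow> \<lambda>k\<in>{i, j}. if k = i then a else b) = x"
      using x by (auto simp: fun_eq_iff PiE_def extensional_def)
    show "(x i, x j) \<in> {1, -1} \<times> {1, -1}"
      using x by (auto simp: PiE_def Pi_def)
    show "(case (x i, x j) of (x, y) \<Rightarrow> x_ln_x ((1 + m i * x + m j * y + chi {i, j} * x * y) / 4)) =
      x_ln_x ((1 + (\<Sum>i\<in>{i, j}. m i * x i) + chi {i, j} * (\<Prod>i\<in>{i, j}. x i)) / 4)"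
      using assms by (simp add: algebra_simps)
  qed (use assms in \<open>auto simp: PiE_def extensional_def\<close>)
  then show ?thesis
    by (simp only: sum.cartesian_product)
qed

text \<open>
  The coordinate space \<open>\<real>\<^bsup>|V|+|E|\<^esup>\<close> is \<open>real ^ 'n\<close>, where \<open>c\<close> identifies the disjoint
  union \<open>V <+> E\<close> with the index type \<open>'n\<close>: the coordinate \<open>c (Inl i)\<close> of \<open>\<eta>\<close> is
  \<open>m i\<close> and the coordinate \<open>c (Inr e)\<close> is \<open>chi e\<close>.
\<close>

definition coordinate_indexing :: "'v set \<Rightarrow> 'v set set \<Rightarrow> ('v + 'v set \<Rightarrow> 'n) \<Rightarrow> bool" where
  "coordinate_indexing V E c \<longleftrightarrow> bij_betw c (V <+> E) UNIV"

definition mag :: "('v + 'v set \<Rightarrow> 'n) \<Rightarrow> real ^ 'n \<Rightarrow> 'v \<Rightarrow> real" where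
  "mag c \<eta> i = \<eta> $ c (Inl i)"

definition corr :: "('v + 'v set \<Rightarrow> 'n) \<Rightarrow> real ^ 'n \<Rightarrow> 'v set \<Rightarrow> real" where
  "corr c \<eta> e = \<eta> $ c (Inr e)"

definition bethe_domain :: "'v set \<Rightarrow> 'v set set \<Rightarrow> ('v + 'v set \<Rightarrow> 'n) \<Rightarrow> (real ^ 'n) set" where
  "bethe_domain V E c = {\<eta>. (\<forall>i\<in>V. \<bar>mag c \<eta> i\<bar> < 1) \<and>
     (\<forall>i j. {i, j} \<in> E \<longrightarrow> (\<forall>x\<in>{1, -1}. \<forall>y\<in>{1, -1}.
        1 + mag c \<eta> i * x + mag c \<eta> j * y + corr c \<eta> {i, j} * x * y > 0))}"

text \<open>
  Only the values on the open set \<open>bethe_domain V E c\<close> matter, where all arguments of \<open>x_ln_x\<close> are positive.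
\<close>

definition bethe_free_energy ::
  "'v set \<Rightarrow> 'v set set \<Rightarrow> ('v set \<Rightarrow> real) \<Rightarrow> ('v \<Rightarrow> real) \<Rightarrow> ('v + 'v set \<Rightarrow> 'n) \<Rightarrow> real ^ 'n \<Rightarrow> real" where
  "bethe_free_energy V E J h c \<eta> =
     - (\<Sum>e\<in>E. J e * corr c \<eta> e) - (\<Sum>i\<in>V. h i * mag c \<eta> i)
     + (\<Sum>e\<in>E. edge_entropy (mag c \<eta>) (corr c \<eta>) e)
     + (\<Sum>i\<in>V. (1 - real (vertex_degree E i)) * (\<Sum>x\<in>{1, -1}. x_ln_x ((1 + mag c \<eta> i * x) / 2)))"

definition gradient :: "(real ^ 'n \<Rightarrow> real) \<Rightarrow> real ^ 'n \<Rightarrow> real ^ 'n" where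
  "gradient f x = (\<chi> k. frechet_derivative f (at x) (axis k 1))"

definition hessian :: "(real ^ 'n \<Rightarrow> real) \<Rightarrow> real ^ 'n \<Rightarrow> real ^ 'n ^ 'n" where
  "hessian f x = jacobian (gradient f) (at x)"

end

theory Submission
  imports Defs
begin

text \<open>
  Write \<open>\<theta>\<^sub>i = artanh m\<^sub>i\<close> and let \<open>K\<^sub>e\<close> be the coupling of the pairwise distribution on the edge \<open>e\<close>
  with moments \<open>(m\<^sub>i, m\<^sub>j, \<chi>\<^sub>e)\<close>. The map \<open>\<Theta> = (\<theta>, K)\<close> is a diffeomorphism from \<open>L\<close> onto the whole
  coordinate space, its Jacobian is triangular with positive diagonal, and
  \<open>\<nabla>F = \<Theta> - (h, J) - (\<Sum>\<^sub>e u\<^sub>e\<^sub>i, 0)\<close> where \<open>|u\<^sub>e\<^sub>i| \<le> |K\<^sub>e|\<close>. Hence the solutions of \<open>\<Theta> = t (\<Theta> - \<nabla>F)\<close>,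
  \<open>0 \<le> t \<le> 1\<close>, are bounded uniformly in \<open>t\<close>, and in the coordinates \<open>\<Theta>\<close> the map \<open>\<nabla>F\<close> has the degree of
  the identity.

  For the degree theory, let \<open>P\<close> be a \<open>C\<^sup>1\<close> map that is the identity outside a ball \<open>B\<close>. The integral of
  \<open>det (I + t (P' - I))\<close> over \<open>B\<close> is a polynomial in \<open>t\<close> and equals \<open>vol B\<close> for small \<open>t\<close>, where
  \<open>I + t (P - I)\<close> permutes \<open>B\<close>; hence the integral of \<open>det P'\<close> is \<open>vol B\<close>. This applies to \<open>g\<close> and to
  \<open>g \<circ> P\<close>, where \<open>g\<close> is a radial map whose Jacobian vanishes except near \<open>0\<close> and far out. Comparing
  the two integrals leaves only the neighbourhoods of the zeros of \<open>P\<close>, each contributing the same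
  amount with the sign of \<open>det P'\<close>.
\<close>

section \<open>Determinants\<close>

lemma continuous_on_det:
  fixes A :: "'a::topological_space \<Rightarrow> real^'n^'n"
  assumes "continuous_on S A"
  shows "continuous_on S (\<lambda>x. det (A x))"
  unfolding det_def by (intro continuous_intros assms)

lemma det_pos_of_path:
  fixes A :: "real \<Rightarrow> real^'n^'n"
  assumes "continuous_on {0..1} A" and "\<And>t. t \<in> {0..1} \<Longrightarrow> det (A t) \<noteq> 0" and "det (A 0) > 0"
  shows "det (A 1) > 0"
proof (rule ccontr)
  assume "\<not> det (A 1) > 0"
  then have "\<exists>t\<ge>0. t \<le> 1 \<and> det (A t) = 0"
    using assms(3) by (intro IVT2' continuous_on_det assms(1)) auto
  then show False
    using assms(2) by auto
qed

lemma det_ne_0_of_kernel: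
  fixes A :: "real^'n^'n"
  assumes "\<And>v. A *v v = 0 \<Longrightarrow> v = 0"
  shows "det A \<noteq> 0"
proof -
  have "inj ((*v) A)"
    using assms linear_injective_0[of "(*v) A"] by simp
  then show ?thesis
    using det_nz_iff_inj[of "(*v) A"] by simp
qed

lemma matrix_vector_mult_scaleR:
  fixes A :: "real^'n^'m"
  shows "(t *\<^sub>R A) *v x = t *\<^sub>R (A *v x)"
  by (simp add: vec_eq_iff matrix_vector_mult_def sum_distrib_left mult.assoc)

text \<open>For \<open>u > 0\<close>, a kernel vector of \<open>(1 - u) I + u A\<close> is an
  eigenvector of \<open>A\<close> for \<open>- (1 - u) / u\<close>, which is at most 0. So the
  segment from the identity to \<open>A\<close> contains no singular matrix, and the determinant
  keeps its sign along it.\<close>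

lemma det_pos_of_no_nonpos_eigenvalue:
  fixes A :: "real^'n^'n"
  assumes "\<And>l v. l \<le> 0 \<Longrightarrow> A *v v = l *\<^sub>R v \<Longrightarrow> v = 0"
  shows "det A > 0"
proof -
  have "det ((1 - u) *\<^sub>R mat 1 + u *\<^sub>R A) \<noteq> 0" if u: "u \<in> {0..1}" for u
  proof (rule det_ne_0_of_kernel)
    fix v assume "((1 - u) *\<^sub>R mat 1 + u *\<^sub>R A) *v v = 0"
    then have eq: "(1 - u) *\<^sub>R v + u *\<^sub>R (A *v v) = 0"
      by (simp add: matrix_vector_mult_add_rdistrib matrix_vector_mult_scaleR)
    show "v = 0"
    proof (cases "u = 0")
      case False
      have "u *\<^sub>R (A *v v) = - ((1 - u) *\<^sub>R v)"
        using eq unfolding eq_neg_iff_add_eq_0 by (simp only: add.commute)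
      also have "\<dots> = u *\<^sub>R ((- (1 - u) / u) *\<^sub>R v)"
        using False by (simp add: scaleR_left_diff_distrib)
      finally have "A *v v = (- (1 - u) / u) *\<^sub>R v"
        by (rule scaleR_left_imp_eq[OF False])
      moreover have "- (1 - u) / u \<le> 0"
        using u False by (simp add: divide_nonpos_pos)
      ultimately show ?thesis
        using assms by blast
    qed (use eq in simp)
  qed
  then have "det ((1 - 1) *\<^sub>R mat 1 + 1 *\<^sub>R A) > 0"
    by (intro det_pos_of_path[of "\<lambda>u. (1 - u) *\<^sub>R mat 1 + u *\<^sub>R A"] continuous_intros) auto
  then show ?thesis by simp
qed

lemma norm_matrix_vector_mult_le:
  fixes A :: "real^'n^'m"
  shows "norm (A *v x) \<le> (\<Sum>i\<in>UNIV. \<Sum>j\<in>UNIV. \<bar>A $ i $ j\<bar>) * norm x"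
proof -
  have "norm (A *v x) \<le> (\<Sum>i\<in>UNIV. \<bar>(A *v x) $ i\<bar>)"
    by (rule norm_le_l1_cart)
  also have "\<dots> \<le> (\<Sum>i\<in>UNIV. \<Sum>j\<in>UNIV. \<bar>A $ i $ j\<bar> * norm x)"
  proof (rule sum_mono)
    fix i
    have "\<bar>(A *v x) $ i\<bar> \<le> (\<Sum>j\<in>UNIV. \<bar>A $ i $ j * x $ j\<bar>)"
      unfolding matrix_vector_mult_def by (simp add: sum_abs)
    also have "\<dots> \<le> (\<Sum>j\<in>UNIV. \<bar>A $ i $ j\<bar> * norm x)"
      by (intro sum_mono) (simp add: abs_mult mult_left_mono component_le_norm_cart)
    finally show "\<bar>(A *v x) $ i\<bar> \<le> (\<Sum>j\<in>UNIV. \<bar>A $ i $ j\<bar> * norm x)" .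
  qed
  finally show ?thesis
    by (simp add: sum_distrib_right)
qed

section \<open>Perturbations of the identity with compact support\<close>

text \<open>The uniform degree bound lets finitely many continuous coefficients be integrated
  separately, so that the integral of \<open>poly (p x) t\<close> over \<open>x\<close> is again a
  polynomial in \<open>t\<close>.\<close>

definition poly_family :: "'a::topological_space set \<Rightarrow> ('a \<Rightarrow> real poly) \<Rightarrow> bool" where
  "poly_family S p \<longleftrightarrow> (\<exists>N. \<forall>x. degree (p x) \<le> N) \<and> (\<forall>k. continuous_on S (\<lambda>x. coeff (p x) k))"

lemma poly_family_const: "poly_family S (\<lambda>x. q)"
  unfolding poly_family_def by auto

lemma poly_family_linear:
  assumes "continuous_on S a" "continuous_on S b"
  shows "poly_family S (\<lambda>x. [:a x, b x:])"
  unfolding poly_family_def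
proof (intro conjI allI exI[of _ 1])
  fix k show "continuous_on S (\<lambda>x. coeff [:a x, b x:] k)"
    using assms by (cases k; cases "k - 1") (auto simp: coeff_pCons)
qed simp

lemma poly_family_add:
  assumes "poly_family S p" "poly_family S q"
  shows "poly_family S (\<lambda>x. p x + q x)"
proof -
  obtain M N where "\<forall>x. degree (p x) \<le> M" "\<forall>x. degree (q x) \<le> N"
    using assms unfolding poly_family_def by auto
  then have "degree (p x + q x) \<le> max M N" for x
    by (metis degree_add_le max.coboundedI1 max.coboundedI2)
  then show ?thesis
    using assms unfolding poly_family_def by (auto intro!: continuous_intros)
qed

lemma poly_family_mult:
  assumes "poly_family S p" "poly_family S q"
  shows "poly_family S (\<lambda>x. p x * q x)"
proof -
  obtain M N where "\<forall>x. degree (p x) \<le> M" "\<forall>x. degree (q x) \<le> N"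
    using assms unfolding poly_family_def by auto
  then have "degree (p x * q x) \<le> M + N" for x
    by (meson add_mono degree_mult_le order_trans)
  then show ?thesis
    using assms unfolding poly_family_def by (auto simp: coeff_mult intro!: continuous_intros)
qed

lemma poly_family_sum:
  assumes "\<And>i. i \<in> I \<Longrightarrow> poly_family S (p i)"
  shows "poly_family S (\<lambda>x. \<Sum>i\<in>I. p i x)"
  using assms
  by (induction I rule: infinite_finite_induct) (auto intro: poly_family_const poly_family_add)

lemma poly_family_prod:
  assumes "\<And>i. i \<in> I \<Longrightarrow> poly_family S (p i)"
  shows "poly_family S (\<lambda>x. \<Prod>i\<in>I. p i x)"
  using assms
  by (induction I rule: infinite_finite_induct) (auto intro: poly_family_const poly_family_mult)

text \<open>Leibniz expansion: each matrix entry is a polynomial of degree at most 1 in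
  \<open>t\<close> whose coefficients are continuous in \<open>x\<close>.\<close>

lemma det_line_poly_family:
  fixes A :: "'a::topological_space \<Rightarrow> real^'n^'n"
  assumes "continuous_on S A"
  obtains p where "poly_family S p" "\<And>x t. det (mat 1 + t *\<^sub>R A x) = poly (p x) t"
proof
  define p where "p x = (\<Sum>q\<in>{q. q permutes (UNIV::'n set)}.
    [:of_int (sign q):] * (\<Prod>i\<in>UNIV. [:(mat 1 :: real^'n^'n) $ i $ q i, A x $ i $ q i:]))" for x
  show "poly_family S p"
    unfolding p_def
    by (intro poly_family_sum poly_family_mult poly_family_const poly_family_prod poly_family_linear
        continuous_intros assms)
  show "det (mat 1 + t *\<^sub>R A x) = poly (p x) t" for x t
    by (simp add: det_def p_def poly_sum poly_prod)
qed

lemma absolutely_integrable_compact: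
  fixes f :: "'a::euclidean_space \<Rightarrow> 'b::euclidean_space"
  assumes "compact S" "continuous_on S f"
  shows "f absolutely_integrable_on S"
proof -
  have "integrable lborel (\<lambda>x. indicator S x *\<^sub>R f x)"
    by (rule borel_integrable_compact[OF assms])
  then show ?thesis
    unfolding set_integrable_def by (simp add: integrable_completion borel_measurable_integrable)
qed

lemma poly_family_integral:
  fixes p :: "'a::euclidean_space \<Rightarrow> real poly"
  assumes "poly_family S p" "compact S"
  obtains P where "\<And>t. integral S (\<lambda>x. poly (p x) t) = poly P t"
proof -
  obtain N where N: "\<And>x. degree (p x) \<le> N"
    using assms(1) unfolding poly_family_def by auto
  have int: "(\<lambda>x. coeff (p x) k) integrable_on S" for k
    using assms set_lebesgue_integral_eq_integral(1)[OF absolutely_integrable_compact]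
    unfolding poly_family_def by blast
  define P where "P = (\<Sum>k\<le>N. monom (integral S (\<lambda>x. coeff (p x) k)) k)"
  have "integral S (\<lambda>x. poly (p x) t) = poly P t" for t
  proof -
    have "poly (p x) t = (\<Sum>k\<le>N. coeff (p x) k * t ^ k)" for x
      unfolding poly_altdef using N by (intro sum.mono_neutral_left) (auto simp: coeff_eq_0)
    then have "integral S (\<lambda>x. poly (p x) t) = integral S (\<lambda>x. \<Sum>k\<le>N. coeff (p x) k * t ^ k)"
      by simp
    also have "\<dots> = (\<Sum>k\<le>N. integral S (\<lambda>x. coeff (p x) k * t ^ k))"
      by (intro integral_sum integrable_on_mult_left int) auto
    also have "\<dots> = poly P t"
      by (simp add: P_def poly_sum poly_monom)
    finally show ?thesis .
  qed
  then show ?thesis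
    using that by blast
qed

lemma poly_eq_const_of_interval:
  fixes P :: "real poly"
  assumes "d > 0" "\<And>t. 0 \<le> t \<Longrightarrow> t < d \<Longrightarrow> poly P t = c"
  shows "poly P s = c"
proof -
  have "infinite {0..<d}"
    using assms(1) by (simp add: infinite_Ico)
  moreover have "{0..<d} \<subseteq> {t. poly (P - [:c:]) t = 0}"
    using assms(2) by auto
  ultimately have "P - [:c:] = 0"
    using finite_subset poly_roots_finite by blast
  then show ?thesis
    by simp
qed

text \<open>For \<open>0 <= t < 1 / L\<close> the map \<open>x + t W x\<close> is a bijection of the
  ball with positive Jacobian determinant, so the integral of that determinant is the volume. The
  integral is a polynomial in \<open>t\<close>, hence constant, and \<open>t = 1\<close> is the
  claim, although the map need not be injective there.\<close>

lemma integral_det_compact_perturbation: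
  fixes W :: "real^'n::{finite,wellorder} \<Rightarrow> real^'n::_" and W' :: "real^'n::_ \<Rightarrow> real^'n::_^'n::_"
  assumes der: "\<And>x. (W has_derivative (*v) (W' x)) (at x)"
    and cont: "continuous_on UNIV W'"
    and supp: "\<And>x. norm x \<ge> r \<Longrightarrow> W x = 0"
  shows "integral (cball 0 r) (\<lambda>x. det (mat 1 + W' x)) = measure lebesgue (cball (0::real^'n::_) r)"
proof -
  \<comment> \<open>This makes the derivative bound global, so that \<open>W\<close> is Lipschitz on
    the whole space and the fixed point theorem applies there.\<close>
  have W'0: "W' x = 0" if "norm x > r" for x
  proof -
    have "open {x::real^'n::_. norm x > r}"
      by (intro open_Collect_less continuous_intros)
    then have "(W has_derivative (\<lambda>h. 0)) (at x)"
      by (rule has_derivative_transform_within_open[OF has_derivative_const[of 0]])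
        (use that supp in auto)
    then have "(*v) (W' x) = (\<lambda>h. 0)"
      using der has_derivative_unique by blast
    then show ?thesis
      by (simp add: matrix_eq fun_eq_iff)
  qed
  define s where "s x = (\<Sum>i\<in>UNIV. \<Sum>j\<in>UNIV. \<bar>W' x $ i $ j\<bar>)" for x
  have "continuous_on (cball 0 r) s"
    unfolding s_def by (intro continuous_intros continuous_on_subset[OF cont]) auto
  then have "bounded (s ` cball 0 r)"
    using compact_cball compact_continuous_image compact_imp_bounded by blast
  then obtain B where B: "\<And>x. x \<in> cball 0 r \<Longrightarrow> norm (s x) \<le> B"
    unfolding bounded_iff by blast
  \<comment> \<open>The added 1 keeps \<open>L\<close> positive, so that \<open>1 / L\<close> is a
    positive threshold for \<open>t\<close>.\<close>
  define L where "L = max B 0 + 1"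
  have "L > 0"
    by (simp add: L_def)
  have sL: "s x \<le> L" for x
  proof (cases "norm x \<le> r")
    case True
    then show ?thesis using B[of x] by (simp add: L_def)
  next
    case False
    then show ?thesis using W'0[of x] by (simp add: L_def s_def)
  qed
  have W'L: "norm (W' x *v h) \<le> L * norm h" for x h
    by (rule order_trans[OF norm_matrix_vector_mult_le])
      (use sL[of x] in \<open>simp add: s_def mult_right_mono\<close>)
  have Lip: "norm (W x - W y) \<le> L * norm (x - y)" for x y
    by (rule differentiable_bound[of UNIV _ "\<lambda>x. (*v) (W' x)"])
      (use der W'L in \<open>auto intro!: onorm_le\<close>)
  have vol: "integral (cball 0 r) (\<lambda>x. det (mat 1 + t *\<^sub>R W' x)) = measure lebesgue (cball (0::real^'n::_) r)"
    if "0 \<le> t" "t < 1 / L" for t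
  proof -
    have tL: "t * L < 1" "0 \<le> t * L"
      using that \<open>L > 0\<close> by (simp_all add: field_simps)
    define T where "T x = x + t *\<^sub>R W x" for x
    have derT: "(T has_derivative (*v) (mat 1 + t *\<^sub>R W' x)) (at x)" for x
      unfolding T_def
      by (rule has_derivative_eq_rhs[OF has_derivative_add[OF has_derivative_ident
            has_derivative_scaleR_right[OF der]]])
        (simp add: fun_eq_iff matrix_vector_mult_add_rdistrib matrix_vector_mult_scaleR)
    have contr: "norm (t *\<^sub>R W x - t *\<^sub>R W y) \<le> t * L * norm (x - y)" for x y
    proof -
      have "norm (t *\<^sub>R W x - t *\<^sub>R W y) = t * norm (W x - W y)"
        using that by (simp flip: scaleR_diff_right)
      also have "\<dots> \<le> t * (L * norm (x - y))"
        using that Lip by (intro mult_left_mono) auto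
      finally show ?thesis by (simp add: mult.assoc)
    qed
    \<comment> \<open>A solution of \<open>T x = y\<close> is a fixed point of the contraction
      sending \<open>x\<close> to \<open>y - t W x\<close>.\<close>
    have ex1: "\<exists>!x. T x = y" for y
    proof -
      have "\<exists>!x. y - t *\<^sub>R W x = x"
        by (rule banach_fix_type[OF tL(2,1)])
          (use contr in \<open>auto simp: dist_norm norm_minus_commute\<close>)
      moreover have "T x = y \<longleftrightarrow> y - t *\<^sub>R W x = x" for x
        by (auto simp: T_def algebra_simps)
      ultimately show ?thesis by simp
    qed
    have Tid: "T x = x" if "norm x \<ge> r" for x
      using supp[OF that] by (simp add: T_def)
    have inj: "inj_on T (cball 0 r)"
      using ex1 unfolding inj_on_def by metis
    \<comment> \<open>A bijection of the whole space that fixes every point outside the ball maps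
      the ball onto itself.\<close>
    have img: "T ` cball 0 r = cball 0 r"
    proof (intro equalityI subsetI)
      fix y assume "y \<in> T ` cball 0 r"
      then obtain x where x: "norm x \<le> r" "y = T x" by auto
      show "y \<in> cball 0 r"
      proof (rule ccontr)
        assume "y \<notin> cball 0 r"
        then have "norm y > r" by simp
        then have "T y = T x" using Tid[of y] x by simp
        then have "y = x" using ex1 by metis
        then show False using x \<open>norm y > r\<close> by simp
      qed
    next
      fix y :: "real^'n::_" assume y: "y \<in> cball 0 r"
      obtain x where x: "T x = y" using ex1 by metis
      have "norm x \<le> r"
        using Tid[of x] x y by (cases "norm x \<le> r") auto
      then show "y \<in> T ` cball 0 r" using x by force
    qed
    \<comment> \<open>An eigenvalue \<open>l <= 0\<close> with eigenvector \<open>v\<close> would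
      give \<open>(1 - l) |v| <= t L |v|\<close>, where \<open>t L < 1 <= 1 - l\<close>.\<close>
    have pos: "det (mat 1 + t *\<^sub>R W' x) > 0" for x
    proof (rule det_pos_of_no_nonpos_eigenvalue)
      fix l :: real and v
      assume "l \<le> 0" and "(mat 1 + t *\<^sub>R W' x) *v v = l *\<^sub>R v"
      then have "(1 - l) *\<^sub>R v = - (t *\<^sub>R (W' x *v v))"
        by (simp add: matrix_vector_mult_add_rdistrib matrix_vector_mult_scaleR algebra_simps)
      then have "norm ((1 - l) *\<^sub>R v) = norm (t *\<^sub>R (W' x *v v))"
        by (metis norm_minus_cancel)
      then have "(1 - l) * norm v = t * norm (W' x *v v)"
        using \<open>l \<le> 0\<close> \<open>0 \<le> t\<close> by simp
      also have "\<dots> \<le> t * (L * norm v)"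
        using W'L \<open>0 \<le> t\<close> by (simp add: mult_left_mono)
      finally have "(1 - l - t * L) * norm v \<le> 0"
        by (simp add: algebra_simps)
      then show "v = 0"
        using tL \<open>l \<le> 0\<close> by (simp add: mult_le_0_iff)
    qed
    have "((\<lambda>x. \<bar>det (matrix ((*v) (mat 1 + t *\<^sub>R W' x)))\<bar>) has_integral
        measure lebesgue (cball (0::real^'n::_) r)) (cball 0 r)"
      using has_measure_differentiable_image[of "cball 0 r" T "\<lambda>x. (*v) (mat 1 + t *\<^sub>R W' x)"
          "measure lebesgue (cball (0::real^'n::_) r)"]
        derT inj img by (auto intro: has_derivative_at_withinI)
    then show ?thesis
      using pos by (simp add: abs_of_pos integral_unique)
  qed
  obtain p where p: "poly_family (cball 0 r) p" "\<And>x t. det (mat 1 + t *\<^sub>R W' x) = poly (p x) t"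
    using det_line_poly_family[OF continuous_on_subset[OF cont]] by (metis subset_UNIV)
  obtain P where P: "\<And>t. integral (cball 0 r) (\<lambda>x. poly (p x) t) = poly P t"
    using poly_family_integral[OF p(1) compact_cball] by blast
  have "poly P 1 = measure lebesgue (cball (0::real^'n::_) r)"
    by (rule poly_eq_const_of_interval[of "1 / L"]) (use vol p P \<open>L > 0\<close> in auto)
  then show ?thesis
    using p(2)[where t = 1] P[of 1] by simp
qed

text \<open>A real integrand is read as a map into \<open>real^1\<close>, which reduces the scalar
  formula to the vector-valued one.\<close>

lemma integral_change_of_variables_scalar:
  fixes f :: "real^'m::{finite,wellorder} \<Rightarrow> real" and g :: "real^'m::_ \<Rightarrow> real^'m::_"
  assumes "S \<in> sets lebesgue"
    and "\<And>x. x \<in> S \<Longrightarrow> (g has_derivative g' x) (at x within S)"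
    and "inj_on g S"
    and "f absolutely_integrable_on (g ` S)"
  shows "((\<lambda>x. \<bar>det (matrix (g' x))\<bar> * f (g x)) has_integral integral (g ` S) f) S"
  using has_absolute_integral_change_of_variables[OF assms(1-3), of "\<lambda>x. vec (f x) :: real^1"
      "vec (integral (g ` S) f)"] assms(4)
    set_lebesgue_integral_eq_integral(1)[of S "\<lambda>x. \<bar>det (matrix (g' x))\<bar> * f (g x)"]
  unfolding absolutely_integrable_on_1_iff integral_on_1_eq
  by (auto simp: vec_eq_iff has_integral_iff)

section \<open>Continuously differentiable cut-offs and the radial collapse\<close>

text \<open>Squaring smooths the kink of \<open>max 0\<close> just enough for a continuous
  derivative; sums and composites of this function give all the cut-offs below.\<close>

definition pos_part_sq :: "real \<Rightarrow> real" where
  "pos_part_sq u = (max 0 u)\<^sup>2"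

lemma pos_part_sq_has_derivative:
  "(pos_part_sq has_real_derivative 2 * max 0 u) (at u)"
proof -
  consider "u < 0" | "u = 0" | "u > 0" by linarith
  then show ?thesis
  proof cases
    case 1
    then have "((\<lambda>u. 0) has_real_derivative 2 * max 0 u) (at u)"
      by simp
    then show ?thesis
      by (rule has_field_derivative_transform_within_open[of _ _ _ "{..<0}"])
        (use 1 in \<open>auto simp: pos_part_sq_def\<close>)
  next
    case 2
    \<comment> \<open>At the kink, Caratheodory's criterion applies: the slope function seen from 0
      is \<open>max 0\<close> itself.\<close>
    show ?thesis
      unfolding CARAT_DERIV
      by (rule exI[of _ "max 0"]) (use 2 in \<open>auto simp: pos_part_sq_def power2_eq_square max_def intro!: continuous_intros\<close>)
  next
    case 3
    have "((\<lambda>u. u\<^sup>2) has_real_derivative 2 * max 0 u) (at u)"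
      using 3 by (auto intro!: derivative_eq_intros)
    then show ?thesis
      by (rule has_field_derivative_transform_within_open[of _ _ _ "{0<..}"])
        (use 3 in \<open>auto simp: pos_part_sq_def\<close>)
  qed
qed

lemmas pos_part_sq_derivative_intros [derivative_intros] =
  DERIV_chain2[OF pos_part_sq_has_derivative]

lemma continuous_on_pos_part_sq [continuous_intros]:
  "continuous_on S f \<Longrightarrow> continuous_on S (\<lambda>x. pos_part_sq (f x))"
  unfolding pos_part_sq_def by (intro continuous_intros)

text \<open>\<open>A\<close> is \<open>a I\<close> plus \<open>b\<close> times the projection-like
  matrix \<open>z z^T\<close>: it acts as \<open>a\<close> orthogonally to \<open>z\<close> and as
  \<open>a + b (z . z)\<close> along \<open>z\<close>. Pairing the eigenvector equation with
  \<open>z\<close> isolates the second value.\<close>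

lemma det_pos_rank_one_update:
  fixes A :: "real^'n^'n"
  assumes A: "\<And>v. A *v v = a *\<^sub>R v + (b * (z \<bullet> v)) *\<^sub>R z"
    and "a > 0" "a + b * (z \<bullet> z) > 0"
  shows "det A > 0"
proof (rule det_pos_of_no_nonpos_eigenvalue)
  fix l :: real and v assume l: "l \<le> 0" "A *v v = l *\<^sub>R v"
  then have eq: "(a - l) *\<^sub>R v + (b * (z \<bullet> v)) *\<^sub>R z = 0"
    by (simp add: A algebra_simps)
  then have "z \<bullet> ((a - l) *\<^sub>R v + (b * (z \<bullet> v)) *\<^sub>R z) = 0"
    by simp
  then have "(a + b * (z \<bullet> z) - l) * (z \<bullet> v) = 0"
    by (simp add: inner_add_right algebra_simps)
  then have "z \<bullet> v = 0"
    using assms l by auto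
  then show "v = 0"
    using eq assms l by simp
qed

text \<open>
  \<open>g\<close> maps the shell \<open>e \<le> |z| \<le> R\<close> radially onto a sphere: \<open>g z = C z / sqrt (p (z \<bullet> z))\<close>
  where \<open>p s = s\<close> on the shell and \<open>p s = C\<^sup>2\<close> far out.
\<close>

lemma radial_collapse:
  fixes e R :: real
  assumes "0 < e" "e < R"
  obtains g :: "real^'n \<Rightarrow> real^'n" and g' where
    "\<And>z. (g has_derivative (*v) (g' z)) (at z)" "continuous_on UNIV g'"
    "\<And>z. norm z \<ge> R + 1 \<Longrightarrow> g z = z"
    "\<And>z. e \<le> norm z \<Longrightarrow> norm z \<le> R \<Longrightarrow> det (g' z) = 0"
    "\<And>z. norm z < e \<Longrightarrow> det (g' z) > 0"
proof -
  \<comment> \<open>The first correction gives \<open>p 0 = e^4 > 0\<close>, which keeps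
    \<open>g\<close> differentiable at the origin. The other two bend \<open>p\<close> between
    \<open>R\<^sup>2\<close> and \<open>R\<^sup>2 + 1\<close> into the constant
    \<open>R\<^sup>2 + 1/2\<close>; with \<open>C\<close> its square root, \<open>g\<close> is the
    identity far out.\<close>
  define p where "p s = s + pos_part_sq (e\<^sup>2 - s) - pos_part_sq (s - R\<^sup>2) / 2 + pos_part_sq (s - R\<^sup>2 - 1) / 2" for s
  define p' where "p' s = 1 - 2 * max 0 (e\<^sup>2 - s) - max 0 (s - R\<^sup>2) + max 0 (s - R\<^sup>2 - 1)" for s
  define C where "C = sqrt (R\<^sup>2 + 1/2)"
  define f where "f s = C / sqrt (p s)" for s
  define f' where "f' s = - (C * p' s) / (2 * p s * sqrt (p s))" for s
  have eR: "e\<^sup>2 < R\<^sup>2" "0 < e\<^sup>2"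
    using assms by (auto intro: power_strict_mono)
  have Cpos: "C > 0"
    by (simp add: C_def add_nonneg_pos)
  have p_out: "p s = R\<^sup>2 + 1/2" if "s \<ge> R\<^sup>2 + 1" for s
    using that eR by (simp add: p_def pos_part_sq_def max_def power2_eq_square field_simps)
  have p_in: "p s = s + (e\<^sup>2 - s)\<^sup>2" "p' s = 1 - 2 * (e\<^sup>2 - s)" if "s < e\<^sup>2" for s
    using that eR by (simp_all add: p_def p'_def pos_part_sq_def max_def)
  have p_mid: "p s = s" "p' s = 1" if "e\<^sup>2 \<le> s" "s \<le> R\<^sup>2" for s
    using that by (auto simp: p_def p'_def pos_part_sq_def max_def)
  have ppos: "p s > 0" if "s \<ge> 0" for s
  proof -
    consider "s < e\<^sup>2" | "e\<^sup>2 \<le> s" "s \<le> R\<^sup>2" | "R\<^sup>2 < s" "s < R\<^sup>2 + 1" | "s \<ge> R\<^sup>2 + 1" by linarith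
    then show ?thesis
    proof cases
      case 1 then show ?thesis using that by (simp add: p_in add_nonneg_pos)
    next
      case 2
      then have "s > 0" using eR by linarith
      then show ?thesis using 2 by (simp add: p_mid)
    next
      case 3
      then have "(s - R\<^sup>2)\<^sup>2 \<le> s - R\<^sup>2"
        using mult_left_mono[of "s - R\<^sup>2" 1 "s - R\<^sup>2"] by (simp add: power2_eq_square[of "s - R\<^sup>2"])
      then have "s - (s - R\<^sup>2)\<^sup>2 / 2 > 0"
        using that 3 eR by linarith
      then show ?thesis using 3 eR by (simp add: p_def pos_part_sq_def max_def)
    next
      case 4 then show ?thesis by (simp add: p_out add_nonneg_pos)
    qed
  qed
  have fpos: "f s > 0" if "s \<ge> 0" for s
    using ppos[OF that] Cpos by (simp add: f_def)
  have derp: "(p has_real_derivative p' s) (at s)" for s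
    unfolding p_def[abs_def] p'_def by (auto intro!: derivative_eq_intros)
  have derf: "(f has_real_derivative f' s) (at s)" if "s \<ge> 0" for s
    unfolding f_def[abs_def] f'_def using ppos[OF that]
    by (auto intro!: derivative_eq_intros derp simp: field_simps)
  \<comment> \<open>At \<open>s = z . z\<close> the derivative of \<open>g\<close> scales
    \<open>z\<close> by this quantity and directions orthogonal to \<open>z\<close> by
    \<open>f s\<close>. Its sign is that of \<open>p s - s * p' s\<close>, which vanishes on the
    shell, where \<open>p s = s\<close> and \<open>p' s = 1\<close>.\<close>
  have key: "f s + 2 * s * f' s = C * (p s - s * p' s) / (p s * sqrt (p s))" if "s \<ge> 0" for s
    using ppos[OF that] by (simp add: f_def f'_def field_simps)
  define g where "g z = f (z \<bullet> z) *\<^sub>R z" for z :: "real^'n"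
  define g' where "g' z = f (z \<bullet> z) *\<^sub>R mat 1 + (\<chi> i j. 2 * f' (z \<bullet> z) * (z $ i) * (z $ j))" for z :: "real^'n"
  have g'v: "g' z *v v = f (z \<bullet> z) *\<^sub>R v + (2 * f' (z \<bullet> z) * (z \<bullet> v)) *\<^sub>R z" for z v
  proof -
    have "(\<chi> i j. 2 * f' (z \<bullet> z) * (z $ i) * (z $ j)) *v v = (2 * f' (z \<bullet> z) * (z \<bullet> v)) *\<^sub>R z"
      by (simp add: vec_eq_iff matrix_vector_mult_def inner_vec_def sum_distrib_left sum_distrib_right ac_simps)
    then show ?thesis
      by (simp add: g'_def matrix_vector_mult_add_rdistrib matrix_vector_mult_scaleR)
  qed
  show thesis
  proof (rule that[of g g'])
    fix z :: "real^'n"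
    have s: "z \<bullet> z = (norm z)\<^sup>2"
      by (simp add: power2_norm_eq_inner)
    have "((\<lambda>z. f (z \<bullet> z)) has_derivative (\<lambda>h. f' (z \<bullet> z) * (2 * (z \<bullet> h)))) (at z)"
      by (rule has_derivative_compose[OF _ derf[unfolded has_field_derivative_def], THEN has_derivative_eq_rhs,
            of "\<lambda>z. z \<bullet> z" "\<lambda>h. 2 * (z \<bullet> h)"])
        (auto intro!: derivative_eq_intros simp: inner_commute)
    then show "(g has_derivative (*v) (g' z)) (at z)"
      unfolding g_def[abs_def]
      by (rule has_derivative_eq_rhs[OF has_derivative_scaleR[OF _ has_derivative_ident]])
        (simp add: fun_eq_iff g'v)
    show "g z = z" if "norm z \<ge> R + 1"
    proof -
      have "(R + 1)\<^sup>2 \<le> (norm z)\<^sup>2"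
        using that assms by (intro power_mono) auto
      moreover have "(R + 1)\<^sup>2 \<ge> R\<^sup>2 + 1"
        using assms by (simp add: power2_sum)
      ultimately have "p (z \<bullet> z) = R\<^sup>2 + 1/2"
        unfolding s by (intro p_out) linarith
      then show ?thesis
        using Cpos by (simp add: g_def f_def C_def)
    qed
    show "det (g' z) = 0" if "e \<le> norm z" "norm z \<le> R"
    proof -
      have "e\<^sup>2 \<le> z \<bullet> z" "z \<bullet> z \<le> R\<^sup>2"
        unfolding s using that assms by (auto intro: power_mono)
      then have "f (z \<bullet> z) + 2 * (z \<bullet> z) * f' (z \<bullet> z) = 0"
        by (simp add: key p_mid)
      then have "(f (z \<bullet> z) + 2 * f' (z \<bullet> z) * (z \<bullet> z)) *\<^sub>R z = 0"
        by (simp add: ac_simps)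
      then have "g' z *v z = 0"
        unfolding g'v by (simp add: scaleR_add_left)
      moreover have "z \<noteq> 0"
        using that assms by auto
      ultimately have "\<not> inj ((*v) (g' z))"
        by (metis injD matrix_vector_mult_0_right)
      then show ?thesis
        using det_nz_iff_inj[of "(*v) (g' z)"] by auto
    qed
    show "det (g' z) > 0" if "norm z < e"
    proof (rule det_pos_rank_one_update[OF g'v])
      have lt: "z \<bullet> z < e\<^sup>2"
        unfolding s using that assms by (auto intro: power_strict_mono)
      show "f (z \<bullet> z) > 0" by (simp add: fpos)
      have "p (z \<bullet> z) - (z \<bullet> z) * p' (z \<bullet> z) = (e\<^sup>2 - z \<bullet> z)\<^sup>2 + 2 * (z \<bullet> z) * (e\<^sup>2 - z \<bullet> z)"
        using lt by (simp add: p_in algebra_simps)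
      also have "\<dots> > 0"
        using lt by (intro add_pos_nonneg) auto
      finally have "p (z \<bullet> z) - (z \<bullet> z) * p' (z \<bullet> z) > 0" .
      then have "f (z \<bullet> z) + 2 * (z \<bullet> z) * f' (z \<bullet> z) > 0"
        using Cpos ppos[of "z \<bullet> z"] by (simp add: key)
      then show "f (z \<bullet> z) + 2 * f' (z \<bullet> z) * (z \<bullet> z) > 0"
        by (simp add: ac_simps)
    qed
  next
    have "p (z \<bullet> z) > 0" for z :: "real^'n"
      by (simp add: ppos)
    then have "p (z \<bullet> z) \<noteq> 0" for z :: "real^'n"
      by (metis less_irrefl)
    moreover have "continuous_on UNIV (\<lambda>z::real^'n. p (z \<bullet> z))" "continuous_on UNIV (\<lambda>z::real^'n. p' (z \<bullet> z))"
      unfolding p_def p'_def by (intro continuous_intros; simp)+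
    ultimately show "continuous_on UNIV g'"
      unfolding g'_def f_def f'_def by (intro continuous_intros) auto
  qed
qed

section \<open>Counting zeros with sign\<close>

text \<open>The remainder is written as an integral over the whole space, so that remainders for
  different sets \<open>A\<close> can be compared by a pointwise identity of integrands.\<close>

lemma integral_diff_subset:
  fixes f :: "'a::euclidean_space \<Rightarrow> real"
  assumes "f absolutely_integrable_on S" "A \<in> sets lebesgue" "S \<in> sets lebesgue" "A \<subseteq> S"
  shows "integral S f = integral UNIV (\<lambda>x. if x \<in> S - A then f x else 0) + integral A f"
proof -
  have "f integrable_on S - A" "f integrable_on A"
    using assms by (auto intro!: set_lebesgue_integral_eq_integral(1) intro: set_integrable_subset)
  moreover have "(S - A) \<inter> A = {}"
    by auto
  ultimately have "integral ((S - A) \<union> A) f = integral (S - A) f + integral A f"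
    by (intro integral_Un) simp_all
  moreover have "(S - A) \<union> A = S"
    using assms by auto
  ultimately show ?thesis
    by (simp only: integral_restrict_UNIV)
qed

text \<open>The inverse function theorem in matrix language: an inverse of the matrix
  \<open>f' z\<close> supplies the required left inverse of the derivative.\<close>

lemma matrix_local_homeomorphism:
  fixes f :: "real^'n \<Rightarrow> real^'n" and f' :: "real^'n \<Rightarrow> real^'n^'n"
  assumes "open U" and der: "\<And>x. x \<in> U \<Longrightarrow> (f has_derivative (*v) (f' x)) (at x)"
    and cont: "continuous_on U f'" and "z \<in> U" and "det (f' z) \<noteq> 0"
  obtains U' V g where "open U'" "U' \<subseteq> U" "z \<in> U'" "open V" "f z \<in> V" "homeomorphism U' V f g"
proof -
  let ?f' = "\<lambda>x. Blinfun ((*v) (f' x))"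
  have app: "blinfun_apply (Blinfun ((*v) A)) = (*v) A" for A :: "real^'n^'n"
    by (simp add: bounded_linear_Blinfun_apply)
  have "continuous_on U ?f'"
  proof (rule continuous_on_blinfun_componentwise)
    fix i :: "real^'n"
    show "continuous_on U (\<lambda>x. blinfun_apply (?f' x) i)"
      unfolding app matrix_vector_mult_def by (intro continuous_intros cont)
  qed
  moreover obtain A where A: "A ** f' z = mat 1"
    using assms(5) by (metis invertible_det_nz invertible_def)
  have "Blinfun ((*v) A) o\<^sub>L ?f' z = id_blinfun"
  proof (rule blinfun_eqI)
    show "blinfun_apply (Blinfun ((*v) A) o\<^sub>L ?f' z) v = blinfun_apply id_blinfun v" for v
      by (simp add: app matrix_vector_mul_assoc A)
  qed
  ultimately show thesis
    using der that by - (rule inverse_function_theorem[of U f ?f' z, OF assms(1) _ _ assms(4)], auto simp: app)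
qed

text \<open>With \<open>D\<close> the Jacobian determinant of a radial collapse \<open>g\<close>,
  the integrals of \<open>D x\<close> and of \<open>D (P x) * det (P' x)\<close> agree, both being
  the volume of a large ball. They cancel away from \<open>ball 0 e\<close> and its preimage
  \<open>N\<close>; the preimage splits into one sheet per zero, each contributing its sign times
  the integral of \<open>D\<close> over \<open>ball 0 e\<close>.\<close>

lemma sum_sgn_det_compact_perturbation:
  fixes W :: "real^'n::{finite,wellorder} \<Rightarrow> real^'n::_" and W' :: "real^'n::_ \<Rightarrow> real^'n::_^'n::_"
  assumes derW: "\<And>x. (W has_derivative (*v) (W' x)) (at x)"
    and contW': "continuous_on UNIV W'"
    and supp: "\<And>x. norm x \<ge> r \<Longrightarrow> W x = 0" and "r > 0"
    and nondeg: "\<And>x. x + W x = 0 \<Longrightarrow> det (mat 1 + W' x) \<noteq> 0"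
  shows "(\<Sum>x\<in>{x. x + W x = 0}. sgn (det (mat 1 + W' x))) = 1"
proof -
  define P where "P x = x + W x" for x
  define P' where "P' x = mat 1 + W' x" for x
  define Z where "Z = {x. P x = 0}"
  have derP: "(P has_derivative (*v) (P' x)) (at x)" for x
    unfolding P_def P'_def
    by (rule has_derivative_eq_rhs[OF has_derivative_add[OF has_derivative_ident derW]])
      (simp add: fun_eq_iff matrix_vector_mult_add_rdistrib)
  have contP: "continuous_on S P" for S
    by (rule has_derivative_continuous_on[OF has_derivative_at_withinI[OF derP]])
  have contW: "continuous_on S W" for S
    by (rule has_derivative_continuous_on[OF has_derivative_at_withinI[OF derW]])
  have contP': "continuous_on S P'" for S
    unfolding P'_def by (intro continuous_intros continuous_on_subset[OF contW']) auto
  have contdet: "continuous_on S (\<lambda>x. det (P' x))" for S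
    by (intro continuous_on_det contP')
  have Pid: "P x = x" if "norm x \<ge> r" for x
    using supp[OF that] by (simp add: P_def)
  have Zr: "norm x < r" if "x \<in> Z" for x
    using that Pid[of x] \<open>r > 0\<close> by (cases "norm x < r") (auto simp: Z_def)
  have detZ: "det (P' z) \<noteq> 0" if "z \<in> Z" for z
    using nondeg that by (simp add: Z_def P_def P'_def)

  have homeo: "\<exists>U V g. open U \<and> U \<subseteq> S \<and> z \<in> U \<and> open V \<and> 0 \<in> V \<and> homeomorphism U V P g"
    if "z \<in> Z" "open S" "z \<in> S" for z S
  proof (rule matrix_local_homeomorphism[OF that(2) derP contP' that(3) detZ[OF that(1)]])
    fix U V g
    assume "open U" "U \<subseteq> S" "z \<in> U" "open V" "P z \<in> V" "homeomorphism U V P g"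
    moreover have "P z = 0" using that(1) by (simp add: Z_def)
    ultimately show ?thesis by metis
  qed
  \<comment> \<open>Zeros are isolated because \<open>P\<close> is locally injective at each of
    them, and they all lie in a compact ball.\<close>
  have "finite Z"
  proof -
    have "\<not> z islimpt Z" if "z \<in> cball 0 r" for z
    proof
      assume "z islimpt Z"
      moreover have "closed Z"
        unfolding Z_def by (intro closed_Collect_eq contP continuous_on_const)
      ultimately have "z \<in> Z"
        using closed_limpt by blast
      then obtain U V g where U: "open U" "z \<in> U" "homeomorphism U V P g"
        using homeo[of z UNIV] by auto
      obtain y where "y \<in> Z" "y \<in> U" "y \<noteq> z"
        using \<open>z islimpt Z\<close> U unfolding islimpt_def by blast
      then show False
        using U \<open>z \<in> Z\<close> unfolding Z_def homeomorphism_def by (metis mem_Collect_eq)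
    qed
    then have "finite (cball 0 r \<inter> Z)"
      by (intro finite_not_islimpt_in_compact) auto
    moreover have "cball 0 r \<inter> Z = Z"
      using less_imp_le[OF Zr] by auto
    ultimately show ?thesis by simp
  qed

  \<comment> \<open>The last clause keeps \<open>U\<close> within half the distance to any other
    zero; by the triangle inequality the chosen neighbourhoods are then pairwise disjoint.\<close>
  define good where "good z U V \<longleftrightarrow> open U \<and> z \<in> U \<and> open V \<and> 0 \<in> V \<and> inj_on P U \<and> P ` U = V \<and>
      (\<forall>x\<in>U. sgn (det (P' x)) = sgn (det (P' z))) \<and> (\<forall>y\<in>Z. y \<noteq> z \<longrightarrow> (\<forall>x\<in>U. dist x z < dist z y / 2))"
    for z U V
  have "\<exists>UV. good z (fst UV) (snd UV)"
    if z: "z \<in> Z" for z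
  proof -
    obtain d where d: "d > 0" "\<forall>y\<in>Z. y \<noteq> z \<longrightarrow> d \<le> dist z y"
      using finite_set_avoid[OF \<open>finite Z\<close>] by blast
    define S where "S = ball z (d / 2) \<inter> {x. det (P' x) * sgn (det (P' z)) > 0}"
    have "open S"
      unfolding S_def by (intro open_Int open_ball open_Collect_less continuous_intros contdet)
    moreover have "z \<in> S"
      using d(1) detZ[OF z] by (simp add: S_def sgn_if)
    ultimately obtain U V g where *: "open U" "U \<subseteq> S" "z \<in> U" "open V" "0 \<in> V" "homeomorphism U V P g"
      using homeo[OF z] by metis
    have "sgn (det (P' x)) = sgn (det (P' z))" if "x \<in> U" for x
      using that *(2) by (auto simp: S_def sgn_if zero_less_mult_iff split: if_splits)
    moreover have "dist x z < dist z y / 2" if "y \<in> Z" "y \<noteq> z" "x \<in> U" for x y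
    proof -
      have "dist x z < d / 2" using that(3) *(2) by (auto simp: S_def dist_commute)
      then show ?thesis using d(2) that by fastforce
    qed
    moreover have "inj_on P U" "P ` U = V"
      using *(6) unfolding homeomorphism_def by (auto intro: inj_on_inverseI)
    ultimately have "good z U V"
      using * unfolding good_def by blast
    then show ?thesis
      by (metis fst_conv snd_conv)
  qed
  then obtain UV where "\<And>z. z \<in> Z \<Longrightarrow> good z (fst (UV z)) (snd (UV z))"
    by metis
  moreover define U V where "U z = fst (UV z)" and "V z = snd (UV z)" for z
  ultimately have good: "good z (U z) (V z)" if "z \<in> Z" for z
    using that by simp
  have UV: "\<And>z. z \<in> Z \<Longrightarrow> open (U z)" "\<And>z. z \<in> Z \<Longrightarrow> z \<in> U z"
      "\<And>z. z \<in> Z \<Longrightarrow> open (V z)" "\<And>z. z \<in> Z \<Longrightarrow> 0 \<in> V z" "\<And>z. z \<in> Z \<Longrightarrow> inj_on P (U z)"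
      "\<And>z. z \<in> Z \<Longrightarrow> P ` U z = V z"
      "\<And>z x. z \<in> Z \<Longrightarrow> x \<in> U z \<Longrightarrow> sgn (det (P' x)) = sgn (det (P' z))"
      "\<And>z y x. z \<in> Z \<Longrightarrow> y \<in> Z \<Longrightarrow> y \<noteq> z \<Longrightarrow> x \<in> U z \<Longrightarrow> dist x z < dist z y / 2"
    using good unfolding good_def by (blast+)
  have disj: "U z \<inter> U y = {}" if "z \<in> Z" "y \<in> Z" "z \<noteq> y" for z y
  proof (rule ccontr)
    assume "U z \<inter> U y \<noteq> {}"
    then obtain x where "x \<in> U z" "x \<in> U y" by auto
    then have "dist x z < dist z y / 2" "dist x y < dist y z / 2"
      using UV(8) that by auto
    then show False
      using dist_triangle[of z y x] by (simp add: dist_commute)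
  qed

  \<comment> \<open>By compactness \<open>|P|\<close> has a positive lower bound off the
    neighbourhoods, so small values of \<open>P\<close> occur only inside them.\<close>
  obtain e1 where e1: "e1 > 0" "\<And>x. norm x \<le> r \<Longrightarrow> x \<notin> (\<Union>z\<in>Z. U z) \<Longrightarrow> e1 \<le> norm (P x)"
  proof -
    have "compact (cball 0 r - (\<Union>z\<in>Z. U z))"
      using UV(1) by (intro compact_diff compact_cball open_UN) auto
    then have comp: "compact ((\<lambda>x. norm (P x)) ` (cball 0 r - (\<Union>z\<in>Z. U z)))"
      by (intro compact_continuous_image continuous_intros contP)
    have "0 \<notin> (\<lambda>x. norm (P x)) ` (cball 0 r - (\<Union>z\<in>Z. U z))"
      using UV(2) by (auto simp: Z_def)
    then obtain d where "d > 0" "\<forall>y \<in> (\<lambda>x. norm (P x)) ` (cball 0 r - (\<Union>z\<in>Z. U z)). d \<le> dist 0 y"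
      using separate_point_closed[OF compact_imp_closed[OF comp]] by blast
    then show thesis
      by (intro that[of d]) auto
  qed
  \<comment> \<open>Within this radius every sheet \<open>U z\<close> covers the whole ball around
    0.\<close>
  obtain e2 where e2: "e2 > 0" "\<And>z. z \<in> Z \<Longrightarrow> ball 0 e2 \<subseteq> V z"
  proof -
    have "open (\<Inter>z\<in>Z. V z)" "0 \<in> (\<Inter>z\<in>Z. V z)"
      using \<open>finite Z\<close> UV(3,4) by auto
    then obtain d where "d > 0" "ball 0 d \<subseteq> (\<Inter>z\<in>Z. V z)"
      using openE by blast
    then show thesis using that[of d] by blast
  qed
  \<comment> \<open>The bound \<open>r / 2\<close> forces \<open>e < r\<close>, so points outside
    the ball of radius \<open>r\<close>, where \<open>P\<close> is the identity, lie neither in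
    \<open>N\<close> nor in \<open>ball 0 e\<close>.\<close>
  define e where "e = min (min e1 e2) (r / 2)"
  have e: "0 < e" "e \<le> e1" "e \<le> e2" "e < r"
    using e1(1) e2(1) \<open>r > 0\<close> by (auto simp: e_def)

  have "bounded (W ` cball 0 r)"
    by (intro compact_imp_bounded compact_continuous_image contW compact_cball)
  then obtain B where B: "B > 0" "\<And>x. norm x \<le> r \<Longrightarrow> norm (W x) \<le> B"
    unfolding bounded_pos by auto
  \<comment> \<open>\<open>R\<close> bounds \<open>|P|\<close> on the ball of radius
    \<open>r\<close>, so there \<open>P x\<close> lies either in \<open>ball 0 e\<close> or in the
    shell where \<open>D\<close> vanishes.\<close>
  define R where "R = r + B"
  have R: "e < R" "r < R"
    using e B(1) by (simp_all add: R_def)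
  have PR: "norm (P x) \<le> R" if "norm x \<le> r" for x
    using norm_triangle_ineq[of x "W x"] B(2)[OF that] that by (simp add: P_def R_def)

  obtain g g' where g: "\<And>z. (g has_derivative (*v) (g' z)) (at z)" "continuous_on UNIV g'"
    "\<And>z. norm z \<ge> R + 1 \<Longrightarrow> g z = z"
    "\<And>z. e \<le> norm z \<Longrightarrow> norm z \<le> R \<Longrightarrow> det (g' z) = 0"
    "\<And>z::real^'n::_. norm z < e \<Longrightarrow> det (g' z) > 0"
    using radial_collapse[OF e(1) R(1)] by blast
  define D where "D z = det (g' z)" for z
  define C where "C = cball (0::real^'n::_) (R + 1)"
  have contD: "continuous_on S D" for S
    unfolding D_def by (intro continuous_on_det continuous_on_subset[OF g(2)]) auto
  have contDP: "continuous_on S (\<lambda>x. D (P x))" for S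
    by (rule continuous_on_compose2[OF contD[of UNIV] contP]) auto
  have contg'P: "continuous_on S (\<lambda>x. g' (P x))" for S
    by (rule continuous_on_compose2[OF g(2) contP]) auto
  have int_D: "integral C D = measure lebesgue C"
  proof -
    have "integral C (\<lambda>x. det (mat 1 + (g' x - mat 1))) = measure lebesgue C"
      unfolding C_def
    proof (rule integral_det_compact_perturbation[of "\<lambda>x. g x - x"])
      show "((\<lambda>x. g x - x) has_derivative (*v) (g' x - mat 1)) (at x)" for x
        by (rule has_derivative_eq_rhs[OF has_derivative_diff[OF g(1) has_derivative_ident]])
          (simp add: fun_eq_iff matrix_vector_mult_diff_rdistrib)
    qed (auto intro!: continuous_intros g)
    then show ?thesis by (simp add: D_def[abs_def])
  qed
  \<comment> \<open>The composite of \<open>g\<close> and \<open>P\<close> is also the identity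
    beyond radius \<open>R + 1\<close>; the chain rule makes \<open>D (P x) * det (P' x)\<close> its
    Jacobian determinant.\<close>
  have int_G: "integral C (\<lambda>x. D (P x) * det (P' x)) = measure lebesgue C"
  proof -
    have "integral C (\<lambda>x. det (mat 1 + (g' (P x) ** P' x - mat 1))) = measure lebesgue C"
      unfolding C_def
    proof (rule integral_det_compact_perturbation[of "\<lambda>x. g (P x) - x"])
      show "((\<lambda>x. g (P x) - x) has_derivative (*v) (g' (P x) ** P' x - mat 1)) (at x)" for x
        by (rule has_derivative_eq_rhs[OF has_derivative_diff[OF has_derivative_compose[OF derP g(1)] has_derivative_ident]])
          (simp add: fun_eq_iff matrix_vector_mult_diff_rdistrib matrix_vector_mul_assoc)
      show "g (P x) - x = 0" if "R + 1 \<le> norm x" for x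
        using that g(3)[of x] Pid[of x] R by simp
      show "continuous_on UNIV (\<lambda>x. g' (P x) ** P' x - mat 1)"
        unfolding matrix_matrix_mult_def by (intro continuous_intros contg'P contP')
    qed
    then show ?thesis by (simp add: D_def det_mul)
  qed

  define N where "N = {x. norm (P x) < e}"
  have Nr: "norm x < r" if "x \<in> N" for x
    using that Pid[of x] e by (cases "norm x < r") (auto simp: N_def)
  have "open N"
    unfolding N_def by (intro open_Collect_less continuous_intros contP)
  have subC: "N \<subseteq> C" "ball 0 e \<subseteq> C"
    using Nr R e by (force simp: C_def)+
  have absD: "D absolutely_integrable_on C" and absG: "(\<lambda>x. D (P x) * det (P' x)) absolutely_integrable_on C"
    unfolding C_def by (intro absolutely_integrable_compact compact_cball continuous_intros contD contDP contdet)+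
  have absDe: "D absolutely_integrable_on ball 0 e"
    using set_integrable_subset[OF absD] subC by auto
  have P'id: "det (P' x) = 1" if "norm x > r" for x
  proof -
    have "(P has_derivative (\<lambda>h. h)) (at x)"
      by (rule has_derivative_transform_within_open[OF has_derivative_ident, where s = "{x. norm x > r}"])
        (use that Pid in \<open>auto intro!: open_Collect_less continuous_intros\<close>)
    then have "(*v) (P' x) = (\<lambda>h. h)"
      using derP has_derivative_unique by blast
    then have "P' x = mat 1"
      by (simp add: matrix_eq fun_eq_iff)
    then show ?thesis by simp
  qed
  have int_N: "integral N (\<lambda>x. D (P x) * det (P' x)) = integral (ball 0 e) D"
  proof -
    \<comment> \<open>Up to radius \<open>r\<close> both sides vanish, since \<open>x\<close> and
      \<open>P x\<close> have norm at most \<open>R\<close>; beyond it \<open>P x = x\<close> and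
      \<open>det (P' x) = 1\<close>.\<close>
    have "(if x \<in> C - N then D (P x) * det (P' x) else 0) = (if x \<in> C - ball 0 e then D x else 0)" for x
    proof (cases "norm x \<le> r")
      case True
      have "D (P x) = 0" if "x \<notin> N"
        using g(4)[of "P x"] PR[OF True] that by (simp add: N_def D_def)
      moreover have "D x = 0" if "x \<notin> ball 0 e"
        using g(4)[of x] R True that by (simp add: D_def)
      ultimately show ?thesis by auto
    next
      case False
      then have "P x = x" "det (P' x) = 1" "x \<notin> N" "x \<notin> ball 0 e"
        using Pid[of x] P'id[of x] Nr[of x] e by auto
      then show ?thesis by auto
    qed
    then have "integral UNIV (\<lambda>x. if x \<in> C - N then D (P x) * det (P' x) else 0)
        = integral UNIV (\<lambda>x. if x \<in> C - ball 0 e then D x else 0)"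
      by presburger
    moreover have "integral C D = integral UNIV (\<lambda>x. if x \<in> C - ball 0 e then D x else 0) + integral (ball 0 e) D"
      by (rule integral_diff_subset[OF absD]) (use subC in \<open>auto simp: C_def\<close>)
    moreover have "integral C (\<lambda>x. D (P x) * det (P' x))
        = integral UNIV (\<lambda>x. if x \<in> C - N then D (P x) * det (P' x) else 0) + integral N (\<lambda>x. D (P x) * det (P' x))"
      by (rule integral_diff_subset[OF absG]) (use subC \<open>open N\<close> in \<open>auto simp: C_def\<close>)
    ultimately show ?thesis
      using int_D int_G by linarith
  qed

  have int_UN: "((\<lambda>x. D (P x) * det (P' x)) has_integral
      (\<Sum>z\<in>Z. sgn (det (P' z)) * integral (ball 0 e) D)) (\<Union>z\<in>Z. N \<inter> U z)"
  proof (rule has_integral_UN[OF \<open>finite Z\<close>])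
    show "pairwise (\<lambda>i i'. negligible (N \<inter> U i \<inter> (N \<inter> U i'))) Z"
    proof (rule pairwiseI)
      fix z y assume "z \<in> Z" "y \<in> Z" "z \<noteq> y"
      then have "N \<inter> U z \<inter> (N \<inter> U y) = {}" using disj by blast
      then show "negligible (N \<inter> U z \<inter> (N \<inter> U y))" by simp
    qed
    fix z assume z: "z \<in> Z"
    have img: "P ` (N \<inter> U z) = ball 0 e"
    proof (intro equalityI subsetI)
      fix y :: "real^'n::_" assume "y \<in> ball 0 e"
      moreover from this have "y \<in> P ` U z"
        using e2(2)[OF z] UV(6)[OF z] e by auto
      ultimately show "y \<in> P ` (N \<inter> U z)" by (auto simp: N_def)
    qed (auto simp: N_def)
    have "((\<lambda>x. \<bar>det (matrix ((*v) (P' x)))\<bar> * D (P x)) has_integral integral (P ` (N \<inter> U z)) D) (N \<inter> U z)"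
    proof (rule integral_change_of_variables_scalar)
      show "N \<inter> U z \<in> sets lebesgue" using \<open>open N\<close> UV(1)[OF z] by auto
      show "inj_on P (N \<inter> U z)" using UV(5)[OF z] by (auto intro: inj_on_subset)
      show "D absolutely_integrable_on P ` (N \<inter> U z)" unfolding img by (rule absDe)
    qed (rule has_derivative_at_withinI[OF derP])
    then have "((\<lambda>x. sgn (det (P' z)) * (\<bar>det (P' x)\<bar> * D (P x))) has_integral
        sgn (det (P' z)) * integral (ball 0 e) D) (N \<inter> U z)"
      unfolding img by (intro has_integral_mult_right) simp
    \<comment> \<open>The sign of \<open>det (P' x)\<close> is constant on the sheet, so it turns
      the absolute value from the change of variables back into the determinant.\<close>
    then show "((\<lambda>x. D (P x) * det (P' x)) has_integral sgn (det (P' z)) * integral (ball 0 e) D) (N \<inter> U z)"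
    proof (rule has_integral_eq[rotated])
      fix x assume "x \<in> N \<inter> U z"
      then have "sgn (det (P' z)) = sgn (det (P' x))" using UV(7)[OF z, of x] by simp
      then show "sgn (det (P' z)) * (\<bar>det (P' x)\<bar> * D (P x)) = D (P x) * det (P' x)"
        by (simp add: sgn_mult_abs mult.assoc[symmetric])
    qed
  qed
  have UN: "(\<Union>z\<in>Z. N \<inter> U z) = N"
  proof -
    have "x \<in> (\<Union>z\<in>Z. U z)" if "x \<in> N" for x
    proof (rule ccontr)
      assume "x \<notin> (\<Union>z\<in>Z. U z)"
      then have "e1 \<le> norm (P x)"
        using e1(2)[OF less_imp_le[OF Nr[OF that]]] by blast
      then show False
        using that e by (simp add: N_def)
    qed
    then show ?thesis by blast
  qed
  have "(\<Sum>z\<in>Z. sgn (det (P' z)) * integral (ball 0 e) D) = integral (ball 0 e) D"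
    using integral_unique[OF int_UN] unfolding UN int_N by (rule sym)
  then have "(\<Sum>z\<in>Z. sgn (det (P' z))) * integral (ball 0 e) D = 1 * integral (ball 0 e) D"
    by (simp add: sum_distrib_right)
  \<comment> \<open>This permits the cancellation: \<open>D\<close> is positive on the ball and has
    a positive minimum on the concentric closed ball of half the radius.\<close>
  moreover have "integral (ball 0 e) D > 0"
  proof -
    let ?K = "cball (0::real^'n::_) (e / 2)"
    have K: "?K \<subseteq> ball 0 e" using e by auto
    have "\<exists>x\<in>?K. \<forall>y\<in>?K. D x \<le> D y"
      using e by (intro continuous_attains_inf contD) auto
    then obtain x where x: "x \<in> ?K" "\<And>y. y \<in> ?K \<Longrightarrow> D x \<le> D y" by blast
    have absK: "D absolutely_integrable_on ?K"
      using set_integrable_subset[OF absDe] K by auto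
    have "0 < D x * measure lebesgue ?K"
      using g(5)[of x] x(1) K content_cball_pos[of "e / 2" "0::real^'n::_"] e
      by (auto simp: D_def subset_iff)
    also have "\<dots> = integral ?K (\<lambda>y. D x * 1)"
      unfolding lmeasure_integral[OF lmeasurable_cball] by (rule integral_mult_right[symmetric])
    also have "\<dots> \<le> integral ?K D"
      using x(2) set_lebesgue_integral_eq_integral(1)[OF absK]
      by (intro integral_le) (auto intro: integrable_on_const)
    also have "\<dots> \<le> integral (ball 0 e) D"
      using K set_lebesgue_integral_eq_integral(1)[OF absK] set_lebesgue_integral_eq_integral(1)[OF absDe] g(5)
      by (intro integral_subset_le) (auto simp: D_def less_imp_le)
    finally show ?thesis .
  qed
  ultimately show ?thesis
    by (simp add: Z_def P_def P'_def)
qed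

section \<open>Maps with an a priori bound\<close>

text \<open>The displacement \<open>P x - x\<close> is multiplied by a radial cut-off
  \<open>k\<close> with values in \<open>[0, 1]\<close>. A zero of the modified map solves
  \<open>x = k (x - P x)\<close>, so the a priori bound with \<open>t = k\<close> puts it where the
  cut-off is 1 and its derivative 0; there both maps and both Jacobians agree.\<close>

lemma sum_sgn_det_Leray_Schauder_wellorder:
  fixes P :: "real^'n::{finite,wellorder} \<Rightarrow> real^'n::_" and P' :: "real^'n::_ \<Rightarrow> real^'n::_^'n::_"
  assumes derP: "\<And>x. (P has_derivative (*v) (P' x)) (at x)"
    and contP': "continuous_on UNIV P'"
    and bound: "\<And>x t. 0 \<le> t \<Longrightarrow> t \<le> 1 \<Longrightarrow> x = t *\<^sub>R (x - P x) \<Longrightarrow> norm x \<le> R"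
    and nondeg: "\<And>x. P x = 0 \<Longrightarrow> det (P' x) \<noteq> 0"
  shows "(\<Sum>x\<in>{x. P x = 0}. sgn (det (P' x))) = 1"
proof -
  have "R \<ge> 0"
    using bound[of 0 0] by simp
  \<comment> \<open>A function of the squared norm: 1 up to \<open>R\<^sup>2\<close> and 0 from
    \<open>R\<^sup>2 + 1\<close> on.\<close>
  define k where "k s = pos_part_sq (1 - pos_part_sq (s - R\<^sup>2))" for s
  define k' where "k' s = 2 * max 0 (1 - pos_part_sq (s - R\<^sup>2)) * - (2 * max 0 (s - R\<^sup>2))" for s
  have derk: "(k has_real_derivative k' s) (at s)" for s
    unfolding k_def[abs_def] k'_def by (auto intro!: derivative_eq_intros)
  have k01: "0 \<le> k s" "k s \<le> 1" for s
  proof -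
    have "0 \<le> max 0 (1 - pos_part_sq (s - R\<^sup>2))" "max 0 (1 - pos_part_sq (s - R\<^sup>2)) \<le> 1"
      by (simp_all add: pos_part_sq_def)
    then show "0 \<le> k s" "k s \<le> 1"
      unfolding k_def pos_part_sq_def[of "1 - _"] by (simp_all add: power_le_one)
  qed
  have k_in: "k (x \<bullet> x) = 1" "k' (x \<bullet> x) = 0" if "norm x \<le> R" for x :: "real^'n::_"
  proof -
    have "x \<bullet> x \<le> R\<^sup>2"
      using that by (simp add: power2_norm_eq_inner[symmetric] power_mono)
    then show "k (x \<bullet> x) = 1" "k' (x \<bullet> x) = 0"
      by (simp_all add: k_def k'_def pos_part_sq_def)
  qed
  have k_out: "k (x \<bullet> x) = 0" if "norm x \<ge> R + 1" for x :: "real^'n::_"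
  proof -
    have "(R + 1)\<^sup>2 \<le> x \<bullet> x"
      using that \<open>R \<ge> 0\<close> by (simp add: power2_norm_eq_inner[symmetric] power_mono)
    then have "1 \<le> x \<bullet> x - R\<^sup>2"
      using \<open>R \<ge> 0\<close> by (simp add: power2_sum)
    then have "1 \<le> (x \<bullet> x - R\<^sup>2)\<^sup>2"
      by (simp add: one_le_power)
    then have "1 - pos_part_sq (x \<bullet> x - R\<^sup>2) \<le> 0"
      using \<open>1 \<le> x \<bullet> x - R\<^sup>2\<close> by (simp add: pos_part_sq_def)
    then show ?thesis
      by (simp add: k_def pos_part_sq_def[of "1 - _"])
  qed
  define W where "W x = k (x \<bullet> x) *\<^sub>R (P x - x)" for x
  define W' where "W' x = k (x \<bullet> x) *\<^sub>R (P' x - mat 1)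
    + (\<chi> i j. 2 * k' (x \<bullet> x) * (P x - x) $ i * x $ j)" for x
  have contP: "continuous_on UNIV P"
    by (rule has_derivative_continuous_on[OF has_derivative_at_withinI[OF derP]])
  have derW: "(W has_derivative (*v) (W' x)) (at x)" for x
  proof -
    have "((\<lambda>x. k (x \<bullet> x)) has_derivative (\<lambda>h. k' (x \<bullet> x) * (2 * (x \<bullet> h)))) (at x)"
      by (rule has_derivative_compose[OF _ derk[unfolded has_field_derivative_def], THEN has_derivative_eq_rhs,
            of "\<lambda>z. z \<bullet> z" "\<lambda>h. 2 * (x \<bullet> h)"])
        (auto intro!: derivative_eq_intros simp: inner_commute)
    moreover have "(\<chi> i j. 2 * k' (x \<bullet> x) * (P x - x) $ i * x $ j) *v h
        = (k' (x \<bullet> x) * (2 * (x \<bullet> h))) *\<^sub>R (P x - x)" for h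
      by (simp add: vec_eq_iff matrix_vector_mult_def inner_vec_def sum_distrib_left sum_distrib_right ac_simps)
    ultimately show ?thesis
      unfolding W_def[abs_def]
      by (intro has_derivative_eq_rhs[OF has_derivative_scaleR[OF _ has_derivative_diff[OF derP has_derivative_ident]]])
        (auto simp: fun_eq_iff W'_def matrix_vector_mult_add_rdistrib matrix_vector_mult_diff_rdistrib
          matrix_vector_mult_scaleR)
  qed
  have zero: "norm x \<le> R" if "x + W x = 0" for x
    by (rule bound[OF k01, of x "x \<bullet> x"]) (use that in \<open>simp add: W_def algebra_simps eq_neg_iff_add_eq_0\<close>)
  have zeros: "{x. x + W x = 0} = {x. P x = 0}"
  proof (intro equalityI subsetI; clarsimp)
    fix x assume "x + W x = 0"
    moreover from this have "k (x \<bullet> x) = 1" by (rule k_in(1)[OF zero])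
    ultimately show "P x = 0" by (simp add: W_def)
  next
    fix x assume "P x = 0"
    then have "norm x \<le> R" using bound[of 1 x] by simp
    then show "x + W x = 0" using \<open>P x = 0\<close> by (simp add: W_def k_in)
  qed
  have det: "det (mat 1 + W' x) = det (P' x)" if "P x = 0" for x
  proof -
    have "norm x \<le> R" using bound[of 1 x] that by simp
    then have "mat 1 + W' x = P' x" by (simp add: W'_def k_in vec_eq_iff)
    then show ?thesis by simp
  qed
  have "(\<Sum>x\<in>{x. x + W x = 0}. sgn (det (mat 1 + W' x))) = 1"
  proof (rule sum_sgn_det_compact_perturbation[OF derW, of "R + 1"])
    have k: "continuous_on UNIV (\<lambda>x::real^'n::_. k (x \<bullet> x))" "continuous_on UNIV (\<lambda>x::real^'n::_. k' (x \<bullet> x))"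
      unfolding k_def k'_def by (intro continuous_intros)+
    show "continuous_on UNIV W'"
      unfolding W'_def by (intro continuous_intros contP contP' k)
    show "W x = 0" if "R + 1 \<le> norm x" for x
      using k_out[OF that] by (simp add: W_def)
    show "det (mat 1 + W' x) \<noteq> 0" if "x + W x = 0" for x
    proof -
      have "P x = 0" using that zeros by blast
      then show ?thesis by (simp add: det nondeg)
    qed
  qed (use \<open>R \<ge> 0\<close> in simp)
  then show ?thesis
    unfolding zeros by (simp add: det)
qed

text \<open>Conjugation by \<open>f\<close> is a sign-preserving bijection between the permutations
  of the two index types, matching the Leibniz sums term by term.\<close>

lemma det_reindex:
  fixes A :: "'a::comm_ring_1^'n^'n" and f :: "'m::finite \<Rightarrow> 'n::finite"
  assumes "bij f"
  shows "det (\<chi> i j. A $ f i $ f j) = det A"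
proof -
  have inj: "inj f" and surj: "surj f"
    using assms by (auto simp: bij_def)
  have perm: "map_permutation UNIV f p permutes UNIV" if "p permutes UNIV" for p
    using map_permutation_permutes[OF assms that] .
  have "(\<Prod>i\<in>UNIV. A $ f i $ f (p i)) = (\<Prod>i\<in>UNIV. A $ i $ map_permutation UNIV f p i)" for p
    by (subst prod.reindex_bij_betw[OF assms, symmetric]) (simp add: map_permutation_apply[OF inj])
  then show ?thesis
    unfolding det_def
    by (intro sum.reindex_bij_witness[of _ "map_permutation UNIV (inv f)" "map_permutation UNIV f"])
      (auto simp: sign_map_permutation inj perm map_permutation_compose_inv[OF assms] inv_f_f
        map_permutation_compose_inv[OF bij_imp_bij_inv[OF assms]] surj_f_inv_f[OF surj]
        map_permutation_permutes[OF bij_imp_bij_inv[OF assms]])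
qed

text \<open>
  The change of variables theorem of the library is only stated for index types of class
  \<open>wellorder\<close>; every finite index type is in bijection with one of these.
\<close>

typedef 'a well_ordered = "UNIV :: 'a set"
  morphisms of_well_ordered to_well_ordered ..

lemma bij_of_well_ordered: "bij of_well_ordered"
  by (metis UNIV_I bijI' of_well_ordered_inject to_well_ordered_inverse)

instance well_ordered :: (finite) finite
  by standard (metis bij_of_well_ordered bij_betw_finite finite_code)

instantiation well_ordered :: (finite) wellorder
begin

definition less_eq_well_ordered :: "'a well_ordered \<Rightarrow> 'a well_ordered \<Rightarrow> bool" where
  "x \<le> y \<longleftrightarrow> to_nat (of_well_ordered x) \<le> to_nat (of_well_ordered y)"

definition less_well_ordered :: "'a well_ordered \<Rightarrow> 'a well_ordered \<Rightarrow> bool" where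
  "x < y \<longleftrightarrow> to_nat (of_well_ordered x) < to_nat (of_well_ordered y)"

instance
proof
  fix Q :: "'a well_ordered \<Rightarrow> bool" and a
  assume step: "\<And>x. (\<And>y. y < x \<Longrightarrow> Q y) \<Longrightarrow> Q x"
  show "Q a"
    by (induction a rule: measure_induct_rule[of "\<lambda>x. to_nat (of_well_ordered x)"])
      (rule step, simp add: less_well_ordered_def)
qed (auto simp: less_eq_well_ordered_def less_well_ordered_def of_well_ordered_inject)

end

text \<open>The equation in \<open>bound\<close> says that \<open>x\<close> is a zero of
  \<open>(1 - t) x + t P x\<close>, the homotopy from the identity to \<open>P\<close>. Renaming
  coordinates is a linear isometry, so conjugating by it preserves the bound, the zeros and the
  determinants.\<close>

theorem sum_sgn_det_Leray_Schauder:
  fixes P :: "real^'n \<Rightarrow> real^'n" and P' :: "real^'n \<Rightarrow> real^'n^'n"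
  assumes derP: "\<And>x. (P has_derivative (*v) (P' x)) (at x)"
    and contP': "continuous_on UNIV P'"
    and bound: "\<And>x t. 0 \<le> t \<Longrightarrow> t \<le> 1 \<Longrightarrow> x = t *\<^sub>R (x - P x) \<Longrightarrow> norm x \<le> R"
    and nondeg: "\<And>x. P x = 0 \<Longrightarrow> det (P' x) \<noteq> 0"
  shows "(\<Sum>x\<in>{x. P x = 0}. sgn (det (P' x))) = 1"
proof -
  define f :: "'n well_ordered \<Rightarrow> 'n" where "f = of_well_ordered"
  have f: "bij f"
    by (simp add: f_def bij_of_well_ordered)
  have f_inv: "f (inv f j) = j" "inv f (f i) = i" for i j
    using f by (simp_all add: bij_is_surj surj_f_inv_f bij_is_inj)
  define F :: "real^'n \<Rightarrow> real^'n well_ordered" where "F x = (\<chi> i. x $ f i)" for x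
  define G :: "real^'n well_ordered \<Rightarrow> real^'n" where "G y = (\<chi> j. y $ inv f j)" for y
  have FG: "F (G y) = y" and GF: "G (F x) = x" for x y
    by (simp_all add: F_def G_def f_inv)
  have lin: "linear F" "linear G"
    by (auto intro!: linearI simp: F_def G_def vec_eq_iff)
  have bl: "bounded_linear F" "bounded_linear G"
    using lin by (simp_all add: linear_conv_bounded_linear)
  have normG: "norm (G y) = norm y" for y
    unfolding norm_vec_def L2_set_def G_def
    by (simp add: sum.reindex_bij_betw[OF bij_imp_bij_inv[OF f], of "\<lambda>i. (y $ i)\<^sup>2"])
  define Q where "Q y = F (P (G y))" for y
  define Q' where "Q' y = (\<chi> i j. P' (G y) $ f i $ f j)" for y
  have Q'v: "Q' y *v h = F (P' (G y) *v G h)" for y h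
    by (simp add: Q'_def F_def G_def vec_eq_iff matrix_vector_mult_def f_inv
        sum.reindex_bij_betw[OF f, symmetric])
  have det: "det (Q' y) = det (P' (G y))" for y
    unfolding Q'_def by (rule det_reindex[OF f])
  have F0: "F x = 0 \<longleftrightarrow> x = 0" for x
    by (metis GF lin linear_0)
  have contG: "continuous_on UNIV G"
    by (rule linear_continuous_on[OF bl(2)])
  have "(\<Sum>y\<in>{y. Q y = 0}. sgn (det (Q' y))) = 1"
  proof (rule sum_sgn_det_Leray_Schauder_wellorder)
    show "(Q has_derivative (*v) (Q' y)) (at y)" for y
      unfolding Q_def[abs_def]
      by (rule has_derivative_eq_rhs[OF has_derivative_compose[OF has_derivative_compose[OF
              bounded_linear_imp_has_derivative[OF bl(2)] derP] bounded_linear_imp_has_derivative[OF bl(1)]]])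
        (simp add: fun_eq_iff Q'v)
    show "continuous_on UNIV Q'"
      unfolding Q'_def by (intro continuous_intros continuous_on_compose2[OF contP' contG]) auto
    show "norm y \<le> R" if "0 \<le> t" "t \<le> 1" "y = t *\<^sub>R (y - Q y)" for y t
    proof -
      have "G y = t *\<^sub>R (G y - G (Q y))"
        using that(3) lin(2) by (metis linear_diff linear_cmul)
      then have "norm (G y) \<le> R"
        by (intro bound[OF that(1,2)]) (simp add: Q_def GF)
      then show ?thesis by (simp add: normG)
    qed
    show "det (Q' y) \<noteq> 0" if "Q y = 0" for y
      using that nondeg by (simp add: det Q_def F0)
  qed
  moreover have "(\<Sum>y\<in>{y. Q y = 0}. sgn (det (Q' y))) = (\<Sum>x\<in>{x. P x = 0}. sgn (det (P' x)))"
    by (rule sum.reindex_bij_witness[of _ F G]) (auto simp: Q_def F0 FG GF det)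
  ultimately show ?thesis by simp
qed

section \<open>Transport to an open domain along a diffeomorphism\<close>

text \<open>Cramer's rule expresses the entries of the inverse as quotients of determinants, which
  makes continuity visible.\<close>

lemma continuous_right_inverse_matrix:
  fixes A :: "'a::topological_space \<Rightarrow> real^'n^'n"
  assumes "continuous_on S A" "\<And>x. x \<in> S \<Longrightarrow> det (A x) \<noteq> 0"
  obtains X where "continuous_on S X" "\<And>x. x \<in> S \<Longrightarrow> A x ** X x = mat 1"
proof
  define X where "X x = (\<chi> k l. det (\<chi> i j. if j = k then axis l 1 $ i else A x $ i $ j) / det (A x))" for x
  have "continuous_on S (\<lambda>x. \<chi> i j. if j = k then axis l 1 $ i else A x $ i $ j)" for k l
  proof (intro continuous_on_vec_lambda)
    show "continuous_on S (\<lambda>x. if j = k then axis l 1 $ i else A x $ i $ j)" for i j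
      by (cases "j = k") (auto intro!: continuous_intros assms(1))
  qed
  then have "continuous_on S (\<lambda>x. det (\<chi> i j. if j = k then axis l 1 $ i else A x $ i $ j) / det (A x))" for k l
    using assms by (intro continuous_on_divide continuous_on_det) auto
  then show "continuous_on S X"
    unfolding X_def by (intro continuous_on_vec_lambda)
  fix x assume x: "x \<in> S"
  have "A x *v column l (X x) = axis l 1" for l
    unfolding cramer[OF assms(2)[OF x]] by (simp add: column_def X_def)
  moreover have "(A x ** X x) $ i $ l = (A x *v column l (X x)) $ i" for i l
    by (simp add: matrix_matrix_mult_def matrix_vector_mult_def column_def)
  ultimately show "A x ** X x = mat 1"
    by (simp add: vec_eq_iff mat_def axis_def)
qed

text \<open>The result on the whole space is applied to \<open>N\<close> composed with the inverse
  of \<open>T\<close>. Since \<open>det (T' x) > 0\<close>, the extra factor in the Jacobian leaves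
  every sign unchanged.\<close>

lemma sum_sgn_det_change_of_coordinates:
  fixes T N :: "real^'n \<Rightarrow> real^'n" and T' N' :: "real^'n \<Rightarrow> real^'n^'n"
  assumes "open L"
    and derT: "\<And>x. x \<in> L \<Longrightarrow> (T has_derivative (*v) (T' x)) (at x)"
    and contT': "continuous_on L T'"
    and detT': "\<And>x. x \<in> L \<Longrightarrow> det (T' x) > 0"
    and bij: "bij_betw T L UNIV"
    and derN: "\<And>x. x \<in> L \<Longrightarrow> (N has_derivative (*v) (N' x)) (at x)"
    and contN': "continuous_on L N'"
    and bound: "\<And>x t. x \<in> L \<Longrightarrow> 0 \<le> t \<Longrightarrow> t \<le> 1 \<Longrightarrow> T x = t *\<^sub>R (T x - N x) \<Longrightarrow> norm (T x) \<le> R"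
    and nondeg: "\<And>x. x \<in> L \<Longrightarrow> N x = 0 \<Longrightarrow> det (N' x) \<noteq> 0"
  shows "(\<Sum>x\<in>{x\<in>L. N x = 0}. sgn (det (N' x))) = 1"
proof -
  define g where "g = inv_into L T"
  have g: "T (g y) = y" "g y \<in> L" for y
    using bij unfolding g_def bij_betw_def by (auto simp: f_inv_into_f inv_into_into)
  have gT: "g (T x) = x" if "x \<in> L" for x
    using bij that unfolding g_def bij_betw_def by (simp add: inv_into_f_f)
  obtain X where X: "continuous_on L X" "\<And>x. x \<in> L \<Longrightarrow> T' x ** X x = mat 1"
    using continuous_right_inverse_matrix[OF contT'] detT' by (metis less_irrefl)
  have derg: "(g has_derivative (*v) (X (g y))) (at y)" for y
  proof -
    have "(*v) (T' (g y)) \<circ> (*v) (X (g y)) = id"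
      by (simp add: fun_eq_iff matrix_vector_mul_assoc X(2)[OF g(2)])
    then have "(g has_derivative (*v) (X (g y))) (at (T (g y)))"
      by (intro has_derivative_inverse_on[OF \<open>open L\<close> derT gT, where g' = "\<lambda>x. (*v) (X x)"] g(2))
    then show ?thesis
      by (simp add: g(1))
  qed
  have detX: "sgn (det (X x)) = 1" if "x \<in> L" for x
  proof -
    have "det (T' x) * det (X x) = 1"
      using X(2)[OF that] by (simp flip: det_mul)
    then show ?thesis
      using detT'[OF that] by (metis sgn_1_pos zero_less_mult_pos zero_less_one)
  qed
  define P where "P y = N (g y)" for y
  define P' where "P' y = N' (g y) ** X (g y)" for y
  have contg: "continuous_on UNIV g"
    by (rule has_derivative_continuous_on[OF has_derivative_at_withinI[OF derg]])
  have "(\<Sum>y\<in>{y. P y = 0}. sgn (det (P' y))) = 1"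
  proof (rule sum_sgn_det_Leray_Schauder)
    show "(P has_derivative (*v) (P' y)) (at y)" for y
      unfolding P_def[abs_def]
      by (rule has_derivative_eq_rhs[OF has_derivative_compose[OF derg derN[OF g(2)]]])
        (simp add: fun_eq_iff P'_def matrix_vector_mul_assoc)
    have "continuous_on UNIV (\<lambda>y. N' (g y))" "continuous_on UNIV (\<lambda>y. X (g y))"
      by (rule continuous_on_compose2[OF contN' contg] continuous_on_compose2[OF X(1) contg], use g in auto)+
    then show "continuous_on UNIV P'"
      unfolding P'_def matrix_matrix_mult_def by (intro continuous_intros)
    show "norm y \<le> R" if "0 \<le> t" "t \<le> 1" "y = t *\<^sub>R (y - P y)" for y t
      using bound[of "g y" t] that by (simp add: g P_def)
    show "det (P' y) \<noteq> 0" if "P y = 0" for y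
      using nondeg[of "g y"] detX[of "g y"] that by (auto simp: P_def P'_def det_mul g)
  qed
  moreover have "(\<Sum>y\<in>{y. P y = 0}. sgn (det (P' y))) = (\<Sum>x\<in>{x\<in>L. N x = 0}. sgn (det (N' x)))"
    by (rule sum.reindex_bij_witness[of _ T g])
      (auto simp: P_def P'_def g gT det_mul sgn_mult detX)
  ultimately show ?thesis by simp
qed

section \<open>Continuously differentiable scalar functions\<close>

text \<open>The derivative is recorded as a gradient vector, so that the gradients of the components
  can later be stacked as the rows of a Jacobian matrix.\<close>

definition C1_on :: "(real^'n) set \<Rightarrow> (real^'n \<Rightarrow> real) \<Rightarrow> bool" where
  "C1_on S f \<longleftrightarrow> (\<exists>f'. (\<forall>x\<in>S. (f has_derivative (\<lambda>h. f' x \<bullet> h)) (at x)) \<and> continuous_on S f')"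

lemma C1_onI:
  assumes "\<And>x. x \<in> S \<Longrightarrow> (f has_derivative D x) (at x)" "\<And>x h. x \<in> S \<Longrightarrow> D x h = f' x \<bullet> h"
    "continuous_on S f'"
  shows "C1_on S f"
proof -
  have "D x = (\<lambda>h. f' x \<bullet> h)" if "x \<in> S" for x
    using assms(2)[OF that] by auto
  then show ?thesis
    using assms(1,3) unfolding C1_on_def by (metis)
qed

lemma C1_on_const: "C1_on S (\<lambda>x. a)"
  by (rule C1_onI[of _ _ "\<lambda>x h. 0" "\<lambda>x. 0"]) auto

lemma C1_on_nth: "C1_on S (\<lambda>x. x $ k)"
  by (rule C1_onI[of _ _ "\<lambda>x h. h $ k" "\<lambda>x. axis k 1"])
    (auto simp: inner_axis' bounded_linear_imp_has_derivative bounded_linear_vec_nth)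

lemma C1_on_add:
  assumes "C1_on S f" "C1_on S g"
  shows "C1_on S (\<lambda>x. f x + g x)"
proof -
  obtain f' g' where "\<forall>x\<in>S. (f has_derivative (\<lambda>h. f' x \<bullet> h)) (at x)" "continuous_on S f'"
    "\<forall>x\<in>S. (g has_derivative (\<lambda>h. g' x \<bullet> h)) (at x)" "continuous_on S g'"
    using assms unfolding C1_on_def by auto
  then show ?thesis
    by (intro C1_onI[of S _ "\<lambda>x h. f' x \<bullet> h + g' x \<bullet> h" "\<lambda>x. f' x + g' x"])
      (auto intro!: derivative_intros continuous_intros simp: inner_add_left)
qed

lemma C1_on_cmult:
  assumes "C1_on S f"
  shows "C1_on S (\<lambda>x. a * f x)"
proof -
  obtain f' where "\<forall>x\<in>S. (f has_derivative (\<lambda>h. f' x \<bullet> h)) (at x)" "continuous_on S f'"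
    using assms unfolding C1_on_def by auto
  then show ?thesis
    by (intro C1_onI[of S _ "\<lambda>x h. a * (f' x \<bullet> h)" "\<lambda>x. a *\<^sub>R f' x"])
      (auto intro!: has_derivative_mult_right continuous_intros)
qed

lemma C1_on_diff:
  assumes "C1_on S f" "C1_on S g"
  shows "C1_on S (\<lambda>x. f x - g x)"
  using C1_on_add[OF assms(1) C1_on_cmult[OF assms(2), of "-1"]] by simp

lemma C1_on_sum:
  assumes "\<And>i. i \<in> I \<Longrightarrow> C1_on S (f i)"
  shows "C1_on S (\<lambda>x. \<Sum>i\<in>I. f i x)"
  using assms by (induction I rule: infinite_finite_induct) (auto intro: C1_on_const C1_on_add)

lemma C1_on_ln:
  assumes "C1_on S f" "\<And>x. x \<in> S \<Longrightarrow> f x > 0"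
  shows "C1_on S (\<lambda>x. ln (f x))"
proof -
  obtain f' where f': "\<forall>x\<in>S. (f has_derivative (\<lambda>h. f' x \<bullet> h)) (at x)" "continuous_on S f'"
    using assms unfolding C1_on_def by auto
  then have "continuous_on S f"
    by (meson has_derivative_at_withinI has_derivative_continuous_on)
  with f' assms(2) show ?thesis
    by (intro C1_onI[of S _ "\<lambda>x h. (f' x \<bullet> h) * inverse (f x)" "\<lambda>x. inverse (f x) *\<^sub>R f' x"])
      (auto intro!: has_derivative_ln continuous_intros dest: less_imp_neq[OF assms(2)])
qed

lemma C1_on_vec_derivative:
  fixes f :: "real^'n \<Rightarrow> real^'n"
  assumes "\<And>k. C1_on S (\<lambda>x. f x $ k)"
  obtains f' where "\<And>x. x \<in> S \<Longrightarrow> (f has_derivative (*v) (f' x)) (at x)" "continuous_on S f'"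
proof -
  obtain G where G: "\<And>k x. x \<in> S \<Longrightarrow> ((\<lambda>x. f x $ k) has_derivative (\<lambda>h. G k x \<bullet> h)) (at x)"
      "\<And>k. continuous_on S (G k)"
    using assms unfolding C1_on_def by metis
  define f' where "f' x = (\<chi> k. G k x)" for x
  show thesis
  proof
    show "continuous_on S f'"
      unfolding f'_def by (intro continuous_on_vec_lambda G)
    fix x assume x: "x \<in> S"
    have "(f' x *v h) $ k = G k x \<bullet> h" for h k
      by (simp add: f'_def matrix_vector_mult_def inner_vec_def)
    then show "(f has_derivative (*v) (f' x)) (at x)"
      unfolding has_derivative_componentwise_within[of f] using G(1)[OF x]
      by (auto simp: Basis_vec_def inner_axis)
  qed
qed

section \<open>Stationary points of the Bethe free energy\<close>

text \<open>For \<open>|a| < 1\<close> this is \<open>artanh a\<close>, the external field under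
  which a single spin has mean \<open>a\<close>.\<close>

definition spin_field :: "real \<Rightarrow> real" where
  "spin_field a = (ln (1 + a) - ln (1 - a)) / 2"

text \<open>The four expressions are four times the probabilities of the spin pairs when the means
  are \<open>a\<close>, \<open>b\<close> and the mean product is \<open>x\<close>.\<close>

definition edge_feasible :: "real \<Rightarrow> real \<Rightarrow> real \<Rightarrow> bool" where
  "edge_feasible a b x \<longleftrightarrow> 1 + a + b + x > 0 \<and> 1 + a - b - x > 0 \<and> 1 - a + b - x > 0 \<and> 1 - a - b + x > 0"

text \<open>Expanding the log-probability of a spin pair \<open>(s, t)\<close> as a constant plus
  terms in \<open>s\<close>, \<open>t\<close> and \<open>s t\<close>, this is the coefficient of
  \<open>s\<close>, the spin with mean \<open>a\<close>.\<close>

definition edge_field :: "real \<Rightarrow> real \<Rightarrow> real \<Rightarrow> real" where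
  "edge_field a b x = (ln (1 + a + b + x) + ln (1 + a - b - x) - ln (1 - a + b - x) - ln (1 - a - b + x)) / 4"

text \<open>The coefficient of \<open>s t\<close> in the same expansion, that is, a quarter of the
  log odds ratio.\<close>

definition edge_coupling :: "real \<Rightarrow> real \<Rightarrow> real \<Rightarrow> real" where
  "edge_coupling a b x = (ln (1 + a + b + x) - ln (1 + a - b - x) - ln (1 - a + b - x) + ln (1 - a - b + x)) / 4"

lemma edge_feasible_commute: "edge_feasible a b x \<longleftrightarrow> edge_feasible b a x"
  by (auto simp: edge_feasible_def algebra_simps)

lemma edge_coupling_commute: "edge_coupling a b x = edge_coupling b a x"
  by (simp add: edge_coupling_def algebra_simps)

lemma spin_field_less:
  assumes "\<bar>a\<bar> < 1" "\<bar>b\<bar> < 1" "a < b"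
  shows "spin_field a < spin_field b"
proof -
  have "ln (1 + a) < ln (1 + b)" "ln (1 - b) < ln (1 - a)"
    using assms by simp_all
  then show ?thesis by (simp add: spin_field_def)
qed

lemma spin_field_inj:
  assumes "\<bar>a\<bar> < 1" "\<bar>b\<bar> < 1" "spin_field a = spin_field b"
  shows "a = b"
  using spin_field_less[OF assms(1,2)] spin_field_less[OF assms(2,1)] assms(3)
  by (metis less_irrefl linorder_neqE_linordered_idom)

lemma spin_field_tanh: "spin_field (tanh y) = y"
proof -
  have "spin_field (tanh y) = artanh (tanh y)"
    using tanh_real_bounds[of y] by (simp add: spin_field_def artanh_def ln_div)
  then show ?thesis by (simp add: artanh_tanh_real)
qed

lemma edge_coupling_less:
  assumes "edge_feasible a b x" "edge_feasible a b y" "x < y"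
  shows "edge_coupling a b x < edge_coupling a b y"
proof -
  have "ln (1 + a + b + x) < ln (1 + a + b + y)" "ln (1 + a - b - y) < ln (1 + a - b - x)"
    "ln (1 - a + b - y) < ln (1 - a + b - x)" "ln (1 - a - b + x) < ln (1 - a - b + y)"
    using assms by (auto simp: edge_feasible_def)
  then show ?thesis by (simp add: edge_coupling_def)
qed

lemma edge_coupling_inj:
  assumes "edge_feasible a b x" "edge_feasible a b y" "edge_coupling a b x = edge_coupling a b y"
  shows "x = y"
  using edge_coupling_less[OF assms(1,2)] edge_coupling_less[OF assms(2,1)] assms(3)
  by (metis less_irrefl linorder_neqE_linordered_idom)

text \<open>Intermediate values in the multiplied-out form of the equation, which is free of
  logarithms and so makes sense at the endpoints of the feasible interval.\<close>

lemma edge_coupling_surj: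
  assumes "\<bar>a\<bar> < 1" "\<bar>b\<bar> < 1"
  obtains x where "edge_feasible a b x" "edge_coupling a b x = k"
proof -
  \<comment> \<open>The feasible \<open>x\<close> form the open interval from \<open>lo\<close> to
    \<open>hi\<close>. At \<open>lo\<close> the first product in \<open>f\<close> vanishes and at
    \<open>hi\<close> the second, which fixes the signs of \<open>f\<close> there.\<close>
  define lo hi where "lo = \<bar>a + b\<bar> - 1" and "hi = 1 - \<bar>a - b\<bar>"
  define f where "f x = (1 + a + b + x) * (1 - a - b + x) - exp (4 * k) * ((1 + a - b - x) * (1 - a + b - x))" for x
  have lohi: "lo < hi" using assms by (auto simp: lo_def hi_def)
  have feas: "edge_feasible a b x \<longleftrightarrow> lo < x \<and> x < hi" for x
    by (auto simp: edge_feasible_def lo_def hi_def)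
  have zero: "(1 + a + b + lo) * (1 - a - b + lo) = 0" "(1 + a - b - hi) * (1 - a + b - hi) = 0"
    by (auto simp: lo_def hi_def abs_if)
  have "(1 + a - b - lo) * (1 - a + b - lo) > 0" "(1 + a + b + hi) * (1 - a - b + hi) > 0"
    using lohi by (auto simp: lo_def hi_def intro!: mult_pos_pos)
  then have sign: "f lo < 0" "f hi > 0"
    unfolding f_def zero by simp_all
  have "\<exists>x\<ge>lo. x \<le> hi \<and> f x = 0"
    using sign lohi by (intro IVT') (auto simp: f_def intro!: continuous_intros)
  then obtain x where x: "lo \<le> x" "x \<le> hi" "f x = 0" by blast
  then have "lo < x" "x < hi"
    using sign by (metis less_irrefl order_le_less)+
  then have fx: "edge_feasible a b x" by (simp add: feas)
  then have pos: "1 + a + b + x > 0" "1 + a - b - x > 0" "1 - a + b - x > 0" "1 - a - b + x > 0"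
    by (auto simp: edge_feasible_def)
  have "ln ((1 + a + b + x) * (1 - a - b + x)) = ln (exp (4 * k) * ((1 + a - b - x) * (1 - a + b - x)))"
    using x(3) by (simp add: f_def)
  then have "ln (1 + a + b + x) + ln (1 - a - b + x) = 4 * k + (ln (1 + a - b - x) + ln (1 - a + b - x))"
    using pos by (simp add: ln_mult)
  then have "edge_coupling a b x = k"
    by (simp add: edge_coupling_def)
  with fx show thesis by (rule that)
qed

text \<open>The mediant \<open>(p + q) / (r + s)\<close> lies between \<open>q / s\<close> and
  \<open>p / r\<close>.\<close>

lemma ln_mediant_le:
  assumes "p > 0" "q > 0" "r > 0" "s > (0::real)" "ln p - ln r \<ge> ln q - ln s"
  shows "ln (p + q) - ln (r + s) \<le> ln p - ln r" "ln (p + q) - ln (r + s) \<ge> ln q - ln s"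
proof -
  have "ln (q * r) \<le> ln (p * s)"
    using assms by (simp add: ln_mult)
  then have "q * r \<le> p * s"
    using assms by simp
  then have "(p + q) * r \<le> p * (r + s)" "q * (r + s) \<le> (p + q) * s"
    by (simp_all add: algebra_simps)
  then have "ln ((p + q) * r) \<le> ln (p * (r + s))" "ln (q * (r + s)) \<le> ln ((p + q) * s)"
    using assms by (simp_all add: add_pos_pos)
  then show "ln (p + q) - ln (r + s) \<le> ln p - ln r" "ln (p + q) - ln (r + s) \<ge> ln q - ln s"
    using assms by (simp_all add: ln_mult add_pos_pos)
qed

text \<open>
  This is the bound \<open>|u| \<le> |J|\<close> on belief propagation messages: the odds of a spin
  lie between its conditional odds given the two values of the neighbouring spin.
\<close>

lemma abs_spin_field_minus_edge_field_le:
  assumes "edge_feasible a b x"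
  shows "\<bar>spin_field a - edge_field a b x\<bar> \<le> \<bar>edge_coupling a b x\<bar>"
proof -
  let ?p = "1 + a + b + x" and ?q = "1 + a - b - x" and ?r = "1 - a + b - x" and ?s = "1 - a - b + x"
  have pos: "?p > 0" "?q > 0" "?r > 0" "?s > 0"
    using assms by (auto simp: edge_feasible_def)
  \<comment> \<open>Summing over the neighbouring spin gives the marginal of the spin with mean
    \<open>a\<close>.\<close>
  have "?p + ?q = 2 * (1 + a)" "?r + ?s = 2 * (1 - a)" by simp_all
  moreover from this have "1 + a > 0" "1 - a > 0" using pos by linarith+
  ultimately have "ln (?p + ?q) = ln 2 + ln (1 + a)" "ln (?r + ?s) = ln 2 + ln (1 - a)"
    by (simp_all only: ln_mult) simp_all
  then have sf: "spin_field a = (ln (?p + ?q) - ln (?r + ?s)) / 2"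
    by (simp add: spin_field_def)
  \<comment> \<open>Half the conditional log-odds, \<open>(ln ?p - ln ?r) / 2\<close> and
    \<open>(ln ?q - ln ?s) / 2\<close>, are \<open>edge_field\<close> plus and minus
    \<open>edge_coupling\<close>. The mediant bound places \<open>spin_field a\<close> between them;
    the case split is on the sign of the coupling.\<close>
  show ?thesis
  proof (cases "ln ?p - ln ?r \<ge> ln ?q - ln ?s")
    case True
    then show ?thesis
      using ln_mediant_le[OF pos True] unfolding sf edge_field_def edge_coupling_def by (simp add: abs_le_iff field_simps)
  next
    case False
    then have "ln ?q - ln ?s \<ge> ln ?p - ln ?r" by simp
    from ln_mediant_le[OF pos(2,1,4,3) this] this show ?thesis
      unfolding sf edge_field_def edge_coupling_def by (simp add: abs_le_iff field_simps)
  qed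
qed

section \<open>Derivatives of the entropy terms\<close>

lemma has_derivative_x_ln_x [derivative_intros]:
  fixes g :: "'a::real_normed_vector \<Rightarrow> real"
  assumes "(g has_derivative g') (at x)" "g x > 0"
  shows "((\<lambda>x. x_ln_x (g x)) has_derivative (\<lambda>h. (ln (g x) + 1) * g' h)) (at x)"
  unfolding x_ln_x_def using assms
  by (auto intro!: derivative_eq_intros simp: fun_eq_iff field_simps)

text \<open>The gradient of negative entropy in the moments is the vector of natural parameters: in
  each coordinate two of the four signs are positive and two negative, so the terms
  \<open>+ 1\<close> and \<open>ln 4\<close> cancel.\<close>

lemma edge_entropy_has_derivative:
  fixes x :: "real^'n"
  assumes "edge_feasible (x $ i) (x $ j) (x $ k)"
  shows "((\<lambda>x. \<Sum>s\<in>{1, -1}. \<Sum>t\<in>{1, -1}. x_ln_x ((1 + x $ i * s + x $ j * t + x $ k * s * t) / 4))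
    has_derivative (\<lambda>h. edge_field (x $ i) (x $ j) (x $ k) * h $ i + edge_field (x $ j) (x $ i) (x $ k) * h $ j
      + edge_coupling (x $ i) (x $ j) (x $ k) * h $ k)) (at x)"
proof -
  let ?p = "1 + x $ i + x $ j + x $ k" and ?q = "1 + x $ i - x $ j - x $ k"
  let ?r = "1 - x $ i + x $ j - x $ k" and ?s = "1 - x $ i - x $ j + x $ k"
  have pos: "?p > 0" "?q > 0" "?r > 0" "?s > 0"
    using assms by (auto simp: edge_feasible_def)
  have nth: "((\<lambda>x::real^'n. x $ l) has_derivative (\<lambda>h. h $ l)) (at x)" for l
    by (simp add: bounded_linear_imp_has_derivative bounded_linear_vec_nth)
  have "((\<lambda>x. x_ln_x ((1 + x $ i + x $ j + x $ k) / 4) + x_ln_x ((1 + x $ i - x $ j - x $ k) / 4)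
      + (x_ln_x ((1 - x $ i + x $ j - x $ k) / 4) + x_ln_x ((1 - x $ i - x $ j + x $ k) / 4))) has_derivative
    (\<lambda>h. (ln (?p / 4) + 1) * ((h $ i + h $ j + h $ k) / 4) + (ln (?q / 4) + 1) * ((h $ i - h $ j - h $ k) / 4)
      + ((ln (?r / 4) + 1) * ((- h $ i + h $ j - h $ k) / 4) + (ln (?s / 4) + 1) * ((- h $ i - h $ j + h $ k) / 4)))) (at x)"
    by (intro has_derivative_add has_derivative_x_ln_x)
      (use pos in \<open>auto intro!: derivative_eq_intros nth\<close>)
  moreover have "(\<lambda>x. \<Sum>s\<in>{1, -1}. \<Sum>t\<in>{1, -1}. x_ln_x ((1 + x $ i * s + x $ j * t + x $ k * s * t) / 4))
    = (\<lambda>x. x_ln_x ((1 + x $ i + x $ j + x $ k) / 4) + x_ln_x ((1 + x $ i - x $ j - x $ k) / 4)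
      + (x_ln_x ((1 - x $ i + x $ j - x $ k) / 4) + x_ln_x ((1 - x $ i - x $ j + x $ k) / 4)))"
    by (simp add: fun_eq_iff)
  moreover have "(\<lambda>h::real^'n. (ln (?p / 4) + 1) * ((h $ i + h $ j + h $ k) / 4) + (ln (?q / 4) + 1) * ((h $ i - h $ j - h $ k) / 4)
      + ((ln (?r / 4) + 1) * ((- h $ i + h $ j - h $ k) / 4) + (ln (?s / 4) + 1) * ((- h $ i - h $ j + h $ k) / 4)))
    = (\<lambda>h. edge_field (x $ i) (x $ j) (x $ k) * h $ i + edge_field (x $ j) (x $ i) (x $ k) * h $ j
      + edge_coupling (x $ i) (x $ j) (x $ k) * h $ k)"
    using pos by (simp add: fun_eq_iff ln_div edge_field_def edge_coupling_def field_simps)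
  ultimately show ?thesis by simp
qed

lemma spin_entropy_has_derivative:
  fixes x :: "real^'n"
  assumes "\<bar>x $ i\<bar> < 1"
  shows "((\<lambda>x. \<Sum>s\<in>{1, -1}. x_ln_x ((1 + x $ i * s) / 2)) has_derivative (\<lambda>h. spin_field (x $ i) * h $ i)) (at x)"
proof -
  have nth: "((\<lambda>x::real^'n. x $ i) has_derivative (\<lambda>h. h $ i)) (at x)"
    by (simp add: bounded_linear_imp_has_derivative bounded_linear_vec_nth)
  have pos: "1 + x $ i > 0" "1 - x $ i > 0"
    using assms by auto
  have "((\<lambda>x. x_ln_x ((1 + x $ i) / 2) + x_ln_x ((1 - x $ i) / 2)) has_derivative
    (\<lambda>h. (ln ((1 + x $ i) / 2) + 1) * (h $ i / 2) + (ln ((1 - x $ i) / 2) + 1) * (- h $ i / 2))) (at x)"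
    by (intro has_derivative_add has_derivative_x_ln_x)
      (use pos in \<open>auto intro!: derivative_eq_intros nth\<close>)
  moreover have "(\<lambda>h::real^'n. (ln ((1 + x $ i) / 2) + 1) * (h $ i / 2) + (ln ((1 - x $ i) / 2) + 1) * (- h $ i / 2))
      = (\<lambda>h. spin_field (x $ i) * h $ i)"
    using pos by (simp add: fun_eq_iff ln_div spin_field_def field_simps)
  ultimately show ?thesis by simp
qed

lemma C1_on_spin_field:
  assumes "\<And>x. x \<in> S \<Longrightarrow> \<bar>x $ i\<bar> < 1"
  shows "C1_on S (\<lambda>x. spin_field (x $ i))"
  unfolding spin_field_def divide_inverse mult.commute[of _ "inverse _"]
  by (intro C1_on_cmult C1_on_diff C1_on_ln C1_on_add C1_on_const C1_on_nth) (force dest: assms)+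

lemma
  assumes "\<And>x. x \<in> S \<Longrightarrow> edge_feasible (x $ i) (x $ j) (x $ k)"
  shows C1_on_edge_field: "C1_on S (\<lambda>x. edge_field (x $ i) (x $ j) (x $ k))"
    and C1_on_edge_coupling: "C1_on S (\<lambda>x. edge_coupling (x $ i) (x $ j) (x $ k))"
proof -
  note pos = assms[unfolded edge_feasible_def, THEN conjunct1]
    assms[unfolded edge_feasible_def, THEN conjunct2, THEN conjunct1]
    assms[unfolded edge_feasible_def, THEN conjunct2, THEN conjunct2, THEN conjunct1]
    assms[unfolded edge_feasible_def, THEN conjunct2, THEN conjunct2, THEN conjunct2]
  show "C1_on S (\<lambda>x. edge_field (x $ i) (x $ j) (x $ k))" "C1_on S (\<lambda>x. edge_coupling (x $ i) (x $ j) (x $ k))"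
    unfolding edge_field_def edge_coupling_def divide_inverse mult.commute[of _ "inverse _"]
    by (intro C1_on_cmult C1_on_diff C1_on_ln C1_on_add C1_on_const C1_on_nth pos; assumption)+
qed

section \<open>Coordinates and domain for a fixed graph\<close>

locale bethe_graph =
  fixes V :: "'v set" and E :: "'v set set"
    and J :: "'v set \<Rightarrow> real" and h :: "'v \<Rightarrow> real"
    and c :: "'v + 'v set \<Rightarrow> 'n::finite"
  assumes graph: "finite_graph V E"
    and indexing: "coordinate_indexing V E c"
begin

lemma finite_V: "finite V" and finite_E: "finite E"
proof -
  show "finite V" using graph by (simp add: finite_graph_def)
  moreover have "E \<subseteq> Pow V" using graph by (auto simp: finite_graph_def)
  ultimately show "finite E" by (meson finite_Pow_iff finite_subset)
qed

abbreviation vx :: "'v \<Rightarrow> 'n" where "vx i \<equiv> c (Inl i)"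
abbreviation ex :: "'v set \<Rightarrow> 'n" where "ex e \<equiv> c (Inr e)"

lemma coord_eq_iff:
  "i \<in> V \<Longrightarrow> j \<in> V \<Longrightarrow> vx i = vx j \<longleftrightarrow> i = j"
  "e \<in> E \<Longrightarrow> e' \<in> E \<Longrightarrow> ex e = ex e' \<longleftrightarrow> e = e'"
  "i \<in> V \<Longrightarrow> e \<in> E \<Longrightarrow> vx i \<noteq> ex e"
  "i \<in> V \<Longrightarrow> e \<in> E \<Longrightarrow> ex e \<noteq> vx i"
proof -
  have "inj_on c (V <+> E)"
    using indexing by (simp add: coordinate_indexing_def bij_betw_def)
  then have *: "c p = c q \<longleftrightarrow> p = q" if "p \<in> V <+> E" "q \<in> V <+> E" for p q
    using that by (rule inj_on_eq_iff)
  show "i \<in> V \<Longrightarrow> j \<in> V \<Longrightarrow> vx i = vx j \<longleftrightarrow> i = j"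
    "e \<in> E \<Longrightarrow> e' \<in> E \<Longrightarrow> ex e = ex e' \<longleftrightarrow> e = e'"
    "i \<in> V \<Longrightarrow> e \<in> E \<Longrightarrow> vx i \<noteq> ex e" "i \<in> V \<Longrightarrow> e \<in> E \<Longrightarrow> ex e \<noteq> vx i"
    by (simp_all add: * InlI InrI)
qed

lemma coord_cases:
  obtains i where "i \<in> V" "k = vx i" | e where "e \<in> E" "k = ex e"
proof -
  have "k \<in> c ` (V <+> E)"
    using indexing by (simp add: coordinate_indexing_def bij_betw_def)
  then obtain p where "p \<in> V <+> E" "k = c p" by auto
  then show thesis using that by (cases p) auto
qed

text \<open>An arbitrary orientation of each edge, needed for explicit formulas. It is harmless:
  \<open>edge_feasible\<close> and \<open>edge_coupling\<close> are symmetric in the endpoints, and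
  \<open>field_at\<close> is indexed by the vertex.\<close>

definition ends :: "'v set \<Rightarrow> 'v \<times> 'v" where
  "ends e = (SOME p. e = {fst p, snd p} \<and> fst p \<noteq> snd p)"

abbreviation lft :: "'v set \<Rightarrow> 'v" where "lft e \<equiv> fst (ends e)"
abbreviation rgt :: "'v set \<Rightarrow> 'v" where "rgt e \<equiv> snd (ends e)"

lemma ends_eq: "e \<in> E \<Longrightarrow> {lft e, rgt e} = e"
  and ends: "e \<in> E \<Longrightarrow> lft e \<noteq> rgt e" "e \<in> E \<Longrightarrow> lft e \<in> V" "e \<in> E \<Longrightarrow> rgt e \<in> V"
proof -
  assume "e \<in> E"
  then have "card e = 2" "e \<subseteq> V" using graph by (auto simp: finite_graph_def)
  then obtain i j where "e = {i, j}" "i \<noteq> j" by (auto simp: card_2_iff)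
  then have *: "e = {lft e, rgt e} \<and> lft e \<noteq> rgt e"
    unfolding ends_def
    by - (rule someI[of "\<lambda>p. e = {fst p, snd p} \<and> fst p \<noteq> snd p" "(i, j)"], simp)
  show eq: "{lft e, rgt e} = e" by (rule conjunct1[OF *, symmetric])
  show "lft e \<noteq> rgt e" by (rule conjunct2[OF *])
  show "lft e \<in> V" "rgt e \<in> V" using \<open>e \<subseteq> V\<close> eq by blast+
qed

text \<open>Meant for \<open>i\<close> in \<open>e\<close>; the second branch is the value at the
  right endpoint.\<close>

definition field_at :: "real^'n \<Rightarrow> 'v set \<Rightarrow> 'v \<Rightarrow> real" where
  "field_at x e i = (if i = lft e then edge_field (x $ vx (lft e)) (x $ vx (rgt e)) (x $ ex e)
     else edge_field (x $ vx (rgt e)) (x $ vx (lft e)) (x $ ex e))"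

definition coupling :: "real^'n \<Rightarrow> 'v set \<Rightarrow> real" where
  "coupling x e = edge_coupling (x $ vx (lft e)) (x $ vx (rgt e)) (x $ ex e)"

definition vector_of :: "('v \<Rightarrow> real) \<Rightarrow> ('v set \<Rightarrow> real) \<Rightarrow> real^'n" where
  "vector_of f g = (\<chi> k. case inv_into (V <+> E) c k of Inl i \<Rightarrow> f i | Inr e \<Rightarrow> g e)"

lemma vector_of_nth:
  "i \<in> V \<Longrightarrow> vector_of f g $ vx i = f i"
  "e \<in> E \<Longrightarrow> vector_of f g $ ex e = g e"
proof -
  have inv: "inv_into (V <+> E) c (c p) = p" if "p \<in> V <+> E" for p
    using indexing that unfolding coordinate_indexing_def bij_betw_def by (intro inv_into_f_f) auto
  show "i \<in> V \<Longrightarrow> vector_of f g $ vx i = f i" "e \<in> E \<Longrightarrow> vector_of f g $ ex e = g e"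
    by (simp_all add: vector_of_def inv InlI InrI)
qed

lemma vec_eqI:
  assumes "\<And>i. i \<in> V \<Longrightarrow> x $ vx i = y $ vx i" "\<And>e. e \<in> E \<Longrightarrow> x $ ex e = y $ ex e"
  shows "x = (y :: real^'n)"
proof -
  have "x $ k = y $ k" for k
    by (cases k rule: coord_cases) (simp_all add: assms)
  then show ?thesis by (simp add: vec_eq_iff)
qed

abbreviation L :: "(real^'n) set" where "L \<equiv> bethe_domain V E c"

text \<open>The domain quantifies over both orders of every edge; symmetry of
  \<open>edge_feasible\<close> reduces this to the chosen one.\<close>

lemma mem_L_iff: "x \<in> L \<longleftrightarrow> (\<forall>i\<in>V. \<bar>x $ vx i\<bar> < 1) \<and>
    (\<forall>e\<in>E. edge_feasible (x $ vx (lft e)) (x $ vx (rgt e)) (x $ ex e))"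
proof -
  have "(\<forall>s\<in>{1, -1}. \<forall>t\<in>{1, -1}. 1 + x $ vx i * s + x $ vx j * t + x $ ex e * s * t > 0) \<longleftrightarrow>
      edge_feasible (x $ vx i) (x $ vx j) (x $ ex e)" for i j e
    by (auto simp: edge_feasible_def)
  then have *: "x \<in> L \<longleftrightarrow> (\<forall>i\<in>V. \<bar>x $ vx i\<bar> < 1) \<and>
      (\<forall>i j. {i, j} \<in> E \<longrightarrow> edge_feasible (x $ vx i) (x $ vx j) (x $ ex {i, j}))"
    by (simp only: bethe_domain_def mag_def corr_def mem_Collect_eq)
  have "(\<forall>i j. {i, j} \<in> E \<longrightarrow> edge_feasible (x $ vx i) (x $ vx j) (x $ ex {i, j})) \<longleftrightarrow>
      (\<forall>e\<in>E. edge_feasible (x $ vx (lft e)) (x $ vx (rgt e)) (x $ ex e))"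
  proof (intro iffI ballI allI impI)
    fix e assume a: "\<forall>i j. {i, j} \<in> E \<longrightarrow> edge_feasible (x $ vx i) (x $ vx j) (x $ ex {i, j})" "e \<in> E"
    show "edge_feasible (x $ vx (lft e)) (x $ vx (rgt e)) (x $ ex e)"
      using a(1)[rule_format, of "lft e" "rgt e"] a(2) ends_eq[OF a(2)] by simp
  next
    fix i j assume a: "\<forall>e\<in>E. edge_feasible (x $ vx (lft e)) (x $ vx (rgt e)) (x $ ex e)" "{i, j} \<in> E"
    have "(i = lft {i, j} \<and> j = rgt {i, j}) \<or> (i = rgt {i, j} \<and> j = lft {i, j})"
      using ends_eq[OF a(2)] by (auto simp only: doubleton_eq_iff)
    then show "edge_feasible (x $ vx i) (x $ vx j) (x $ ex {i, j})"
      using a edge_feasible_commute by metis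
  qed
  then show ?thesis using * by simp
qed

lemma open_L: "open L"
proof -
  have "L = (\<Inter>i\<in>V. {x. \<bar>x $ vx i\<bar> < 1}) \<inter>
      (\<Inter>e\<in>E. {x. edge_feasible (x $ vx (lft e)) (x $ vx (rgt e)) (x $ ex e)})"
    by (auto simp: mem_L_iff)
  also have "open \<dots>"
    unfolding edge_feasible_def using finite_V finite_E
    by (intro open_Int open_INT ballI open_Collect_less open_Collect_conj continuous_intros) auto
  finally show ?thesis .
qed

abbreviation F :: "real^'n \<Rightarrow> real" where "F \<equiv> bethe_free_energy V E J h c"

section \<open>The gradient and the natural coordinates\<close>

text \<open>Written as \<open>natural_coords\<close> minus the parameters and minus one message term
  per incident edge, each of which is bounded by the coupling on that edge.\<close>

definition bethe_gradient :: "real^'n \<Rightarrow> real^'n" where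
  "bethe_gradient x = vector_of
     (\<lambda>i. spin_field (x $ vx i) - h i - (\<Sum>e\<in>{e\<in>E. i \<in> e}. spin_field (x $ vx i) - field_at x e i))
     (\<lambda>e. coupling x e - J e)"

text \<open>The map \<open>\<Theta>\<close> from the domain to fields and couplings.\<close>

definition natural_coords :: "real^'n \<Rightarrow> real^'n" where
  "natural_coords x = vector_of (\<lambda>i. spin_field (x $ vx i)) (coupling x)"

lemma F_has_derivative:
  assumes x: "x \<in> L"
  shows "(F has_derivative (\<lambda>d. - (\<Sum>e\<in>E. J e * d $ ex e) - (\<Sum>i\<in>V. h i * d $ vx i)
      + (\<Sum>e\<in>E. field_at x e (lft e) * d $ vx (lft e) + field_at x e (rgt e) * d $ vx (rgt e) + coupling x e * d $ ex e)
      + (\<Sum>i\<in>V. (1 - real (vertex_degree E i)) * (spin_field (x $ vx i) * d $ vx i)))) (at x)"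
proof -
  have nth: "((\<lambda>x::real^'n. x $ l) has_derivative (\<lambda>h. h $ l)) (at x)" for l
    by (simp add: bounded_linear_imp_has_derivative bounded_linear_vec_nth)
  have ent: "((\<lambda>x. edge_entropy (mag c x) (corr c x) e) has_derivative (\<lambda>d. field_at x e (lft e) * d $ vx (lft e)
      + field_at x e (rgt e) * d $ vx (rgt e) + coupling x e * d $ ex e)) (at x)" if e: "e \<in> E" for e
  proof -
    have "(\<lambda>x. edge_entropy (mag c x) (corr c x) e) = (\<lambda>x. \<Sum>s\<in>{1, -1}. \<Sum>t\<in>{1, -1}.
        x_ln_x ((1 + x $ vx (lft e) * s + x $ vx (rgt e) * t + x $ ex e * s * t) / 4))"
      using edge_entropy_doubleton[OF ends(1)[OF e]] ends_eq[OF e]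
      by (simp only: mag_def corr_def fun_eq_iff) metis
    moreover have "edge_feasible (x $ vx (lft e)) (x $ vx (rgt e)) (x $ ex e)"
      using x e by (simp add: mem_L_iff)
    ultimately show ?thesis
      using edge_entropy_has_derivative ends(1)[OF e] by (simp add: field_at_def coupling_def)
  qed
  have "((\<lambda>x. - (\<Sum>e\<in>E. J e * corr c x e) - (\<Sum>i\<in>V. h i * mag c x i)
     + (\<Sum>e\<in>E. edge_entropy (mag c x) (corr c x) e)
     + (\<Sum>i\<in>V. (1 - real (vertex_degree E i)) * (\<Sum>s\<in>{1, -1}. x_ln_x ((1 + mag c x i * s) / 2))))
    has_derivative (\<lambda>d. - (\<Sum>e\<in>E. J e * d $ ex e) - (\<Sum>i\<in>V. h i * d $ vx i)
      + (\<Sum>e\<in>E. field_at x e (lft e) * d $ vx (lft e) + field_at x e (rgt e) * d $ vx (rgt e) + coupling x e * d $ ex e)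
      + (\<Sum>i\<in>V. (1 - real (vertex_degree E i)) * (spin_field (x $ vx i) * d $ vx i)))) (at x)"
  proof (intro has_derivative_add has_derivative_diff has_derivative_minus has_derivative_sum
      has_derivative_mult_right ent)
    show "((\<lambda>x. corr c x e) has_derivative (\<lambda>d. d $ ex e)) (at x)" for e
      unfolding corr_def by (rule nth)
    show "((\<lambda>x. mag c x i) has_derivative (\<lambda>d. d $ vx i)) (at x)" for i
      unfolding mag_def by (rule nth)
    show "((\<lambda>x. \<Sum>s\<in>{1, -1}. x_ln_x ((1 + mag c x i * s) / 2)) has_derivative
        (\<lambda>d. spin_field (x $ vx i) * d $ vx i)) (at x)" if "i \<in> V" for i
      unfolding mag_def using x that by (intro spin_entropy_has_derivative) (simp add: mem_L_iff)
  qed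
  then show ?thesis
    by (simp only: bethe_free_energy_def[abs_def])
qed

lemma gradient_F:
  assumes x: "x \<in> L"
  shows "gradient F x = bethe_gradient x"
proof -
  note D = frechet_derivative_at[OF F_has_derivative[OF x], symmetric]
  show ?thesis
  proof (rule vec_eqI)
    fix e assume e: "e \<in> E"
    have [simp]: "axis (ex e) (1::real) $ ex e' = (if e' = e then 1 else 0)" if "e' \<in> E" for e'
      using coord_eq_iff(2)[OF that e] by (simp add: axis_def)
    have [simp]: "axis (ex e) (1::real) $ vx i = 0" if "i \<in> V" for i
      using coord_eq_iff(3)[OF that e] by (simp add: axis_def)
    have "gradient F x $ ex e = - J e + coupling x e"
      using e finite_E by (simp add: gradient_def D ends if_distrib[of "(*) _"] cong: if_cong)
    then show "gradient F x $ ex e = bethe_gradient x $ ex e"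
      by (simp add: bethe_gradient_def vector_of_nth e)
  next
    fix i assume i: "i \<in> V"
    have [simp]: "axis (vx i) (1::real) $ vx j = (if j = i then 1 else 0)" if "j \<in> V" for j
      using coord_eq_iff(1)[OF that i] by (simp add: axis_def)
    have [simp]: "axis (vx i) (1::real) $ ex e = 0" if "e \<in> E" for e
      using coord_eq_iff(4)[OF i that] by (simp add: axis_def)
    have "field_at x e (lft e) * (if lft e = i then 1 else 0) + field_at x e (rgt e) * (if rgt e = i then 1 else 0)
        = (if i \<in> e then field_at x e i else 0)" if "e \<in> E" for e
    proof -
      have "i \<in> e \<longleftrightarrow> i = lft e \<or> i = rgt e" using ends_eq[OF that] by blast
      then show ?thesis using ends(1)[OF that] by auto
    qed
    then have "(\<Sum>e\<in>E. field_at x e (lft e) * (if lft e = i then 1 else 0) + field_at x e (rgt e) * (if rgt e = i then 1 else 0))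
        = (\<Sum>e\<in>{e\<in>E. i \<in> e}. field_at x e i)"
      using finite_E by (simp add: sum.inter_filter)
    then have "gradient F x $ vx i = - h i + (\<Sum>e\<in>{e\<in>E. i \<in> e}. field_at x e i)
        + (1 - real (vertex_degree E i)) * spin_field (x $ vx i)"
      using i finite_V by (simp add: gradient_def D ends if_distrib[of "(*) _"] cong: if_cong)
    \<comment> \<open>The factor \<open>1 - d_i\<close> is absorbed by pairing one copy of
      \<open>spin_field\<close> with each of the \<open>d_i\<close> edges at
      \<open>i\<close>.\<close>
    also have "\<dots> = bethe_gradient x $ vx i"
      by (simp add: bethe_gradient_def vector_of_nth i sum_subtractf vertex_degree_def algebra_simps)
    finally show "gradient F x $ vx i = bethe_gradient x $ vx i" .
  qed
qed

lemma C1_on_spin: "i \<in> V \<Longrightarrow> C1_on L (\<lambda>x. spin_field (x $ vx i))"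
  by (rule C1_on_spin_field) (simp add: mem_L_iff)

lemma C1_on_coupling: "e \<in> E \<Longrightarrow> C1_on L (\<lambda>x. coupling x e)"
  unfolding coupling_def by (rule C1_on_edge_coupling) (simp add: mem_L_iff)

lemma C1_on_field_at: "e \<in> E \<Longrightarrow> C1_on L (\<lambda>x. field_at x e i)"
  unfolding field_at_def
  by (cases "i = lft e")
    (auto intro!: C1_on_edge_field simp: mem_L_iff edge_feasible_commute[of "_ $ vx (rgt e)"])

lemma C1_on_natural_coords: "C1_on L (\<lambda>x. natural_coords x $ k)"
  by (cases k rule: coord_cases)
    (simp_all add: natural_coords_def vector_of_nth C1_on_spin C1_on_coupling)

lemma C1_on_bethe_gradient: "C1_on L (\<lambda>x. bethe_gradient x $ k)"
  by (cases k rule: coord_cases)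
    (auto simp: bethe_gradient_def vector_of_nth
      intro!: C1_on_diff C1_on_sum C1_on_const C1_on_spin C1_on_coupling C1_on_field_at)

text \<open>The map is triangular: the fields determine the means, and for fixed means the coupling
  is a strictly increasing function of the edge coordinate, onto the reals.\<close>

lemma bij_natural_coords: "bij_betw natural_coords L UNIV"
  unfolding bij_betw_def
proof
  show "inj_on natural_coords L"
  proof (rule inj_onI)
    fix x y assume xy: "x \<in> L" "y \<in> L" "natural_coords x = natural_coords y"
    have v: "x $ vx i = y $ vx i" if "i \<in> V" for i
    proof (rule spin_field_inj)
      show "spin_field (x $ vx i) = spin_field (y $ vx i)"
        using arg_cong[OF xy(3), of "\<lambda>z. z $ vx i"] that by (simp add: natural_coords_def vector_of_nth)
    qed (use xy(1,2) that in \<open>simp_all add: mem_L_iff\<close>)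
    show "x = y"
    proof (rule vec_eqI[OF v])
      fix e assume e: "e \<in> E"
      have "coupling x e = coupling y e"
        using arg_cong[OF xy(3), of "\<lambda>z. z $ ex e"] e by (simp add: natural_coords_def vector_of_nth)
      then have "edge_coupling (y $ vx (lft e)) (y $ vx (rgt e)) (x $ ex e)
          = edge_coupling (y $ vx (lft e)) (y $ vx (rgt e)) (y $ ex e)"
        by (simp add: coupling_def v ends e)
      moreover have "edge_feasible (y $ vx (lft e)) (y $ vx (rgt e)) (x $ ex e)"
        using xy(1) e by (simp add: mem_L_iff v[symmetric] ends)
      moreover have "edge_feasible (y $ vx (lft e)) (y $ vx (rgt e)) (y $ ex e)"
        using xy(2) e by (simp add: mem_L_iff)
      ultimately show "x $ ex e = y $ ex e"
        using edge_coupling_inj by blast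
    qed
  qed
  show "natural_coords ` L = UNIV"
  proof (intro equalityI subset_UNIV subsetI)
    fix y :: "real^'n"
    have abs_tanh: "\<bar>tanh u\<bar> < 1" for u :: real
      using tanh_real_bounds[of u] by (simp add: abs_less_iff)
    have "\<exists>x. edge_feasible (tanh (y $ vx (lft e))) (tanh (y $ vx (rgt e))) x \<and>
        edge_coupling (tanh (y $ vx (lft e))) (tanh (y $ vx (rgt e))) x = y $ ex e" for e
      by (rule edge_coupling_surj[OF abs_tanh abs_tanh]) blast
    then obtain f where f: "\<And>e. edge_feasible (tanh (y $ vx (lft e))) (tanh (y $ vx (rgt e))) (f e)"
        "\<And>e. edge_coupling (tanh (y $ vx (lft e))) (tanh (y $ vx (rgt e))) (f e) = y $ ex e"
      by metis
    define x where "x = vector_of (\<lambda>i. tanh (y $ vx i)) f"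
    have "x \<in> L"
      using f(1) by (simp add: mem_L_iff x_def vector_of_nth ends abs_tanh)
    moreover have "natural_coords x = y"
      by (rule vec_eqI) (simp_all add: natural_coords_def vector_of_nth x_def spin_field_tanh coupling_def ends f(2))
    ultimately show "y \<in> natural_coords ` L" by blast
  qed
qed

text \<open>Triangularity in terms of eigenvectors: for \<open>l <= 0\<close> the positive diagonal
  forces the vertex entries of \<open>v\<close> to vanish; each edge row then reduces to its own
  positive diagonal term.\<close>

lemma det_natural_coords_pos:
  assumes x: "x \<in> L" and der: "(natural_coords has_derivative (*v) A) (at x)"
  shows "det A > 0"
proof (rule det_pos_of_no_nonpos_eigenvalue)
  fix l :: real and v assume l: "l \<le> 0" "A *v v = l *\<^sub>R v"
  have nth: "((\<lambda>x::real^'n. x $ k) has_derivative (\<lambda>h. h $ k)) (at x)" for k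
    by (simp add: bounded_linear_imp_has_derivative bounded_linear_vec_nth)
  have comp: "((\<lambda>x. natural_coords x $ k) has_derivative (\<lambda>h. (A *v h) $ k)) (at x)" for k
    using has_derivative_compose[OF der bounded_linear_imp_has_derivative[OF bounded_linear_vec_nth]] .
  have v0: "v $ vx i = 0" if i: "i \<in> V" for i
  proof -
    have pos: "1 + x $ vx i > 0" "1 - x $ vx i > 0"
      using x i by (auto simp: mem_L_iff)
    have "((\<lambda>x. natural_coords x $ vx i) has_derivative
        (\<lambda>h. (h $ vx i * inverse (1 + x $ vx i) - - h $ vx i * inverse (1 - x $ vx i)) / 2)) (at x)"
      unfolding natural_coords_def vector_of_nth(1)[OF i] spin_field_def using pos
      by (auto intro!: derivative_eq_intros nth simp: fun_eq_iff)
    from has_derivative_unique[OF comp this]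
    have "l * v $ vx i = (inverse (1 + x $ vx i) + inverse (1 - x $ vx i)) / 2 * v $ vx i"
      using l(2) by (auto simp: fun_eq_iff algebra_simps dest: spec[of _ v])
    moreover have "(inverse (1 + x $ vx i) + inverse (1 - x $ vx i)) / 2 > 0"
      using pos by (simp add: add_pos_pos)
    ultimately show ?thesis using l(1) by auto
  qed
  show "v = 0"
  proof (rule vec_eqI)
    fix e assume e: "e \<in> E"
    let ?a = "x $ vx (lft e)" and ?b = "x $ vx (rgt e)" and ?c = "x $ ex e"
    have pos: "1 + ?a + ?b + ?c > 0" "1 + ?a - ?b - ?c > 0" "1 - ?a + ?b - ?c > 0" "1 - ?a - ?b + ?c > 0"
      using x e by (auto simp: mem_L_iff edge_feasible_def)
    have "((\<lambda>x. natural_coords x $ ex e) has_derivative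
        (\<lambda>h. ((h $ vx (lft e) + h $ vx (rgt e) + h $ ex e) * inverse (1 + ?a + ?b + ?c)
          - (h $ vx (lft e) - h $ vx (rgt e) - h $ ex e) * inverse (1 + ?a - ?b - ?c)
          - (- h $ vx (lft e) + h $ vx (rgt e) - h $ ex e) * inverse (1 - ?a + ?b - ?c)
          + (- h $ vx (lft e) - h $ vx (rgt e) + h $ ex e) * inverse (1 - ?a - ?b + ?c)) / 4)) (at x)"
      unfolding natural_coords_def vector_of_nth(2)[OF e] coupling_def edge_coupling_def using pos
      by (auto intro!: derivative_eq_intros nth simp: fun_eq_iff)
    from has_derivative_unique[OF comp this]
    have "l * v $ ex e = (inverse (1 + ?a + ?b + ?c) + inverse (1 + ?a - ?b - ?c)
        + inverse (1 - ?a + ?b - ?c) + inverse (1 - ?a - ?b + ?c)) / 4 * v $ ex e"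
      using l(2) v0[OF ends(2)[OF e]] v0[OF ends(3)[OF e]]
      by (auto simp: fun_eq_iff algebra_simps dest: spec[of _ v])
    moreover have "(inverse (1 + ?a + ?b + ?c) + inverse (1 + ?a - ?b - ?c)
        + inverse (1 - ?a + ?b - ?c) + inverse (1 - ?a - ?b + ?c)) / 4 > 0"
      using pos by (simp add: add_pos_pos)
    ultimately show "v $ ex e = 0 $ ex e" using l(1) by auto
  qed (simp add: v0)
qed

lemma abs_field_at_le:
  assumes "x \<in> L" "e \<in> E" "i \<in> e"
  shows "\<bar>spin_field (x $ vx i) - field_at x e i\<bar> \<le> \<bar>coupling x e\<bar>"
proof -
  have "edge_feasible (x $ vx (lft e)) (x $ vx (rgt e)) (x $ ex e)"
    using assms by (simp add: mem_L_iff)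
  then show ?thesis
    using abs_spin_field_minus_edge_field_le[of "x $ vx (lft e)" "x $ vx (rgt e)" "x $ ex e"]
      abs_spin_field_minus_edge_field_le[of "x $ vx (rgt e)" "x $ vx (lft e)" "x $ ex e"]
      ends_eq[OF assms(2)] assms(3)
    by (auto simp: field_at_def coupling_def edge_coupling_commute edge_feasible_commute)
qed

text \<open>The edge equations read \<open>K_e = t J_e\<close>, so couplings are bounded by the
  parameters. The vertex equations read \<open>\<theta>_i = t (h_i + sum of u_ei)\<close> with
  \<open>|u_ei| <= |K_e| <= |J_e|\<close>. A bound on each coordinate then bounds the norm, with the
  dimension as factor.\<close>

lemma natural_coords_bound:
  assumes x: "x \<in> L" and t: "0 \<le> t" "t \<le> 1"
    and eq: "natural_coords x = t *\<^sub>R (natural_coords x - bethe_gradient x)"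
  shows "norm (natural_coords x) \<le> real CARD('n) * ((\<Sum>i\<in>V. \<bar>h i\<bar>) + (\<Sum>e\<in>E. \<bar>J e\<bar>))"
proof -
  define B where "B = (\<Sum>i\<in>V. \<bar>h i\<bar>) + (\<Sum>e\<in>E. \<bar>J e\<bar>)"
  have scale: "\<bar>t * a\<bar> \<le> \<bar>a\<bar>" for a
    using t mult_right_mono[of t 1 "\<bar>a\<bar>"] by (simp add: abs_mult)
  have coup: "\<bar>coupling x e\<bar> \<le> \<bar>J e\<bar>" if "e \<in> E" for e
  proof -
    have "coupling x e = t * J e"
      using arg_cong[OF eq, of "\<lambda>z. z $ ex e"] that by (simp add: natural_coords_def bethe_gradient_def vector_of_nth)
    then show ?thesis using scale by simp
  qed
  have "\<bar>natural_coords x $ k\<bar> \<le> B" for k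
  proof (cases k rule: coord_cases)
    case (1 i)
    let ?s = "\<Sum>e\<in>{e\<in>E. i \<in> e}. spin_field (x $ vx i) - field_at x e i"
    have "spin_field (x $ vx i) = t * (h i + ?s)"
      using arg_cong[OF eq, of "\<lambda>z. z $ vx i"] 1 by (simp add: natural_coords_def bethe_gradient_def vector_of_nth)
    then have "\<bar>spin_field (x $ vx i)\<bar> \<le> \<bar>h i\<bar> + \<bar>?s\<bar>"
      using scale[of "h i + ?s"] by linarith
    moreover have "\<bar>?s\<bar> \<le> (\<Sum>e\<in>{e\<in>E. i \<in> e}. \<bar>J e\<bar>)"
      using abs_field_at_le[OF x] coup by (intro order_trans[OF sum_abs sum_mono]) (force intro: order_trans)
    moreover have "(\<Sum>e\<in>{e\<in>E. i \<in> e}. \<bar>J e\<bar>) \<le> (\<Sum>e\<in>E. \<bar>J e\<bar>)"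
      using finite_E by (intro sum_mono2) auto
    moreover have "\<bar>h i\<bar> \<le> (\<Sum>i\<in>V. \<bar>h i\<bar>)"
      using 1 finite_V by (intro member_le_sum) auto
    ultimately show ?thesis
      using 1 by (simp add: natural_coords_def vector_of_nth B_def)
  next
    case (2 e)
    have "\<bar>J e\<bar> \<le> (\<Sum>e\<in>E. \<bar>J e\<bar>)" "0 \<le> (\<Sum>i\<in>V. \<bar>h i\<bar>)"
      using 2 finite_E by (auto intro!: member_le_sum sum_nonneg)
    moreover have "natural_coords x $ k = coupling x e"
      using 2 by (simp add: natural_coords_def vector_of_nth)
    ultimately show ?thesis
      using coup[OF 2(1)] unfolding B_def by linarith
  qed
  then have "(\<Sum>k\<in>UNIV. \<bar>natural_coords x $ k\<bar>) \<le> real CARD('n) * B"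
    using sum_bounded_above[of UNIV "\<lambda>k. \<bar>natural_coords x $ k\<bar>" B] by simp
  then show ?thesis
    using norm_le_l1_cart[of "natural_coords x"] unfolding B_def by linarith
qed

text \<open>The change of coordinates is applied with \<open>natural_coords\<close> as the
  diffeomorphism and \<open>bethe_gradient\<close> as the map whose zeros are counted.\<close>

lemma sum_sgn_det_hessian:
  assumes "\<forall>x\<in>L. gradient F x = 0 \<longrightarrow> det (hessian F x) \<noteq> 0"
  shows "(\<Sum>x\<in>{x\<in>L. gradient F x = 0}. sgn (det (hessian F x))) = 1"
proof -
  obtain T' where T': "\<And>x. x \<in> L \<Longrightarrow> (natural_coords has_derivative (*v) (T' x)) (at x)" "continuous_on L T'"
    using C1_on_vec_derivative[of L natural_coords] C1_on_natural_coords by blast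
  obtain N' where N': "\<And>x. x \<in> L \<Longrightarrow> (bethe_gradient has_derivative (*v) (N' x)) (at x)" "continuous_on L N'"
    using C1_on_vec_derivative[of L bethe_gradient] C1_on_bethe_gradient by blast
  have hess: "hessian F x = N' x" if x: "x \<in> L" for x
  proof -
    \<comment> \<open>The gradient is known explicitly only on \<open>L\<close>; openness of
      \<open>L\<close> lets its derivative be computed from \<open>bethe_gradient\<close>.\<close>
    have "(gradient F has_derivative (*v) (N' x)) (at x)"
      by (rule has_derivative_transform_within_open[OF N'(1)[OF x] open_L x]) (simp add: gradient_F)
    then show ?thesis
      by (simp add: hessian_def jacobian_def frechet_derivative_at[symmetric])
  qed
  have "(\<Sum>x\<in>{x\<in>L. bethe_gradient x = 0}. sgn (det (N' x))) = 1"
  proof (rule sum_sgn_det_change_of_coordinates[OF open_L T' _ bij_natural_coords N' natural_coords_bound])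
    show "det (T' x) > 0" if "x \<in> L" for x
      using det_natural_coords_pos[OF that T'(1)[OF that]] .
    show "det (N' x) \<noteq> 0" if "x \<in> L" "bethe_gradient x = 0" for x
      using assms that by (simp add: gradient_F hess)
  qed
  moreover have "{x\<in>L. gradient F x = 0} = {x\<in>L. bethe_gradient x = 0}"
    using gradient_F by auto
  ultimately show ?thesis
    by (simp add: hess)
qed

end

theorem theorem5p1:
  fixes V :: "'v set" and E :: "'v set set"
    and J :: "'v set \<Rightarrow> real" and h :: "'v \<Rightarrow> real"
    and c :: "'v + 'v set \<Rightarrow> 'n::finite"
  defines "F \<equiv> bethe_free_energy V E J h c"
  assumes "finite_graph V E"
    and "coordinate_indexing V E c"
    and "\<forall>\<eta> \<in> bethe_domain V E c. gradient F \<eta> = 0 \<longrightarrow> det (hessian F \<eta>) \<noteq> 0"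
  shows "(\<Sum>\<eta> \<in> {\<eta> \<in> bethe_domain V E c. gradient F \<eta> = 0}. sgn (det (hessian F \<eta>))) = 1"
proof -
  interpret bethe_graph V E J h c
    using assms(2,3) by unfold_locales
  show ?thesis
    using sum_sgn_det_hessian assms(4) unfolding F_def by blast
qed

end
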